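(* Let $n\ge3$ be an integer. (1) If $\ell\ge7$ is odd, then $$\left|\max{}^+_{B_n^{(1)}}(\ell\Lambda_0)\right|=\left|\max{}^+_{B_{(\ell-1)/2}^{(1)}}\bigl((2n+1)\Lambda_0\bigr)\right| .$$ (2) If $\ell\ge8$ is even, then $$\left|\max{}^+_{B_n^{(1)}}\bigl((\ell-1)\Lambda_0+\Lambda_n\bigr)\right|=\left|\max{}^+_{B_{\ell/2-1}^{(1)}}\bigl((2n+1)\Lambda_0+\Lambda_{\ell/2-1}\bigr)\right| .$$
   Context: For an affine Kac--Moody algebra $\mathfrak g$ with null root $\delta$ and a dominant integral weight $\Lambda$, a weight $\mu$ of the irreducible highest weight module $V(\Lambda)$ is maximal if $\mu+\delta$ is not a weight of $V(\Lambda)$; $\max^+_{\mathfrak g}(\Lambda)$ is the set of maximal weights of $V(\Lambda)$ that are dominant integral. For $B_r^{(1)}$ ($r\ge3$) the vertices are labelled $0,\dots,r$ in the standard (Kac) way: the canonical central element is $\sum a_i^\vee h_i$ with $(a_0^\vee,\dots,a_r^\vee)=(1,1,2,\dots,2,1)$, deleting vertex $0$ leaves $B_r$ with $\alpha_r$ the short simple root, and $\Lambda_i$ are the corresponding fundamental weights (on each side those of the algebra indicated). *)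

theory Defs
  imports Complex_Main "HOL-Library.Function_Algebras" "HOL-Library.Equipollence"
begin

section \<open>The affine Cartan datum of type \<open>B\<^sub>r\<^sup>(\<^sup>1\<^sup>)\<close>, for r at least 3\<close>

text \<open>
  Kac's conventions: the vertices are 0, ..., r and the entry at (i, j) is
  \<open>\<langle>h\<^sub>i, \<alpha>\<^sub>j\<rangle>\<close>. Vertices 0 and 1 are both joined to 2,
  then comes the chain 2, ..., r, and \<open>\<alpha>\<^sub>r\<close> is short. Only the values
  at indices at most r, with r at least 3, are meaningful.
\<close>

definition cartan_B :: "nat \<Rightarrow> nat \<Rightarrow> nat \<Rightarrow> int" where
  "cartan_B r i j =
    (if i = j then 2
     else if (i = 0 \<and> j = 2) \<or> (i = 2 \<and> j = 0) then -1
     else if i = r \<and> j = r - 1 then -2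
     else if 1 \<le> i \<and> 1 \<le> j \<and> (j = Suc i \<or> i = Suc j) then -1
     else 0)"

definition mark_B :: "nat \<Rightarrow> nat" where
  "mark_B i = (if i \<le> 1 then 1 else 2)"

definition comark_B :: "nat \<Rightarrow> nat \<Rightarrow> nat" where
  "comark_B r i = (if i \<le> 1 \<or> i = r then 1 else 2)"

text \<open>
  The Cartan subalgebra has the basis consisting of the simple coroots
  \<open>h\<^sub>0, \<dots>, h\<^sub>r\<close> and the scaling element d. A linear functional on it is
  represented by its values on this basis, extended by 0 to the coroot symbols of index
  greater than r, so that the representing function is unique.
\<close>

datatype cartan_elt = Coroot nat | Scaling

definition cartan_basis :: "nat \<Rightarrow> cartan_elt set" where
  "cartan_basis r = insert Scaling (Coroot ` {..r})"

type_synonym weight = "cartan_elt \<Rightarrow> complex"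

definition cartan_dual :: "nat \<Rightarrow> weight set" where
  "cartan_dual r = {\<mu>. \<forall>b. b \<notin> cartan_basis r \<longrightarrow> \<mu> b = 0}"

definition scale_weight :: "complex \<Rightarrow> weight \<Rightarrow> weight" (infixr \<open>*\<^sub>w\<close> 75) where
  "c *\<^sub>w \<mu> = (\<lambda>b. c * \<mu> b)"

definition simple_root :: "nat \<Rightarrow> nat \<Rightarrow> weight" where
  "simple_root r j b =
    (case b of
       Coroot i \<Rightarrow> (if i \<le> r then of_int (cartan_B r i j) else 0)
     | Scaling \<Rightarrow> (if j = 0 then 1 else 0))"

definition null_root :: "nat \<Rightarrow> weight" where
  "null_root r = (\<Sum>i\<le>r. of_nat (mark_B i) *\<^sub>w simple_root r i)"

definition fundamental_weight :: "nat \<Rightarrow> weight" where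
  "fundamental_weight i b = (if b = Coroot i then 1 else 0)"

definition dominant_integral :: "nat \<Rightarrow> weight \<Rightarrow> bool" where
  "dominant_integral r \<mu> \<longleftrightarrow> \<mu> \<in> cartan_dual r \<and> (\<forall>i\<le>r. \<mu> (Coroot i) \<in> \<nat>)"


section \<open>The affine Kac--Moody algebra, by generators and relations\<close>

datatype lie_term =
    Gen_e nat | Gen_f nat | Gen_h cartan_elt
  | Zero | Add lie_term lie_term | Scale complex lie_term | Br lie_term lie_term

text \<open>
  The congruence generated by the axioms of a complex Lie algebra and the Chevalley--Serre
  relations. The generator symbols of index greater than r are discarded by setting them
  equal to 0.
\<close>

inductive km_eq :: "nat \<Rightarrow> lie_term \<Rightarrow> lie_term \<Rightarrow> bool" for r :: nat where
  km_refl: "km_eq r x x"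
| km_sym: "km_eq r x y \<Longrightarrow> km_eq r y x"
| km_trans: "km_eq r x y \<Longrightarrow> km_eq r y z \<Longrightarrow> km_eq r x z"
| cong_Add: "km_eq r x x' \<Longrightarrow> km_eq r y y' \<Longrightarrow> km_eq r (Add x y) (Add x' y')"
| cong_Scale: "km_eq r x x' \<Longrightarrow> km_eq r (Scale c x) (Scale c x')"
| cong_Br: "km_eq r x x' \<Longrightarrow> km_eq r y y' \<Longrightarrow> km_eq r (Br x y) (Br x' y')"
| add_assoc: "km_eq r (Add (Add x y) z) (Add x (Add y z))"
| add_comm: "km_eq r (Add x y) (Add y x)"
| add_zero: "km_eq r (Add Zero x) x"
| add_neg: "km_eq r (Add (Scale (-1) x) x) Zero"
| scale_one: "km_eq r (Scale 1 x) x"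
| scale_scale: "km_eq r (Scale a (Scale b x)) (Scale (a * b) x)"
| scale_add: "km_eq r (Scale a (Add x y)) (Add (Scale a x) (Scale a y))"
| add_scale: "km_eq r (Scale (a + b) x) (Add (Scale a x) (Scale b x))"
| br_add_left: "km_eq r (Br (Add x y) z) (Add (Br x z) (Br y z))"
| br_add_right: "km_eq r (Br x (Add y z)) (Add (Br x y) (Br x z))"
| br_scale_left: "km_eq r (Br (Scale a x) y) (Scale a (Br x y))"
| br_scale_right: "km_eq r (Br x (Scale a y)) (Scale a (Br x y))"
| br_alternating: "km_eq r (Br x x) Zero"
| br_jacobi: "km_eq r (Add (Br x (Br y z)) (Add (Br y (Br z x)) (Br z (Br x y)))) Zero"
| rel_HH: "b \<in> cartan_basis r \<Longrightarrow> b' \<in> cartan_basis r \<Longrightarrow> km_eq r (Br (Gen_h b) (Gen_h b')) Zero"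
| rel_HE: "b \<in> cartan_basis r \<Longrightarrow> j \<le> r \<Longrightarrow>
    km_eq r (Br (Gen_h b) (Gen_e j)) (Scale (simple_root r j b) (Gen_e j))"
| rel_HF: "b \<in> cartan_basis r \<Longrightarrow> j \<le> r \<Longrightarrow>
    km_eq r (Br (Gen_h b) (Gen_f j)) (Scale (- simple_root r j b) (Gen_f j))"
| rel_EF: "i \<le> r \<Longrightarrow> km_eq r (Br (Gen_e i) (Gen_f i)) (Gen_h (Coroot i))"
| rel_EF_ne: "i \<le> r \<Longrightarrow> j \<le> r \<Longrightarrow> i \<noteq> j \<Longrightarrow> km_eq r (Br (Gen_e i) (Gen_f j)) Zero"
| serre_E: "i \<le> r \<Longrightarrow> j \<le> r \<Longrightarrow> i \<noteq> j \<Longrightarrow>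
    km_eq r ((Br (Gen_e i) ^^ nat (1 - cartan_B r i j)) (Gen_e j)) Zero"
| serre_F: "i \<le> r \<Longrightarrow> j \<le> r \<Longrightarrow> i \<noteq> j \<Longrightarrow>
    km_eq r ((Br (Gen_f i) ^^ nat (1 - cartan_B r i j)) (Gen_f j)) Zero"
| discard_E: "i > r \<Longrightarrow> km_eq r (Gen_e i) Zero"
| discard_F: "i > r \<Longrightarrow> km_eq r (Gen_f i) Zero"
| discard_H: "b \<notin> cartan_basis r \<Longrightarrow> km_eq r (Gen_h b) Zero"

definition km_class :: "nat \<Rightarrow> lie_term \<Rightarrow> lie_term set" where
  "km_class r x = {y. km_eq r x y}"

definition affine_B :: "nat \<Rightarrow> lie_term set set" where
  "affine_B r = range (km_class r)"

definition km_add :: "nat \<Rightarrow> lie_term set \<Rightarrow> lie_term set \<Rightarrow> lie_term set" where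
  "km_add r X Y = (\<Union>x\<in>X. \<Union>y\<in>Y. km_class r (Add x y))"

definition km_scale :: "nat \<Rightarrow> complex \<Rightarrow> lie_term set \<Rightarrow> lie_term set" where
  "km_scale r c X = (\<Union>x\<in>X. km_class r (Scale c x))"

definition km_bracket :: "nat \<Rightarrow> lie_term set \<Rightarrow> lie_term set \<Rightarrow> lie_term set" where
  "km_bracket r X Y = (\<Union>x\<in>X. \<Union>y\<in>Y. km_class r (Br x y))"

lemma km_class_eq_iff: "km_class r x = km_class r y \<longleftrightarrow> km_eq r x y"
  unfolding km_class_def by (auto intro: km_refl km_sym km_trans)

lemma km_add_class: "km_add r (km_class r x) (km_class r y) = km_class r (Add x y)"
proof -
  have "km_class r (Add x' y') = km_class r (Add x y)"
    if "x' \<in> km_class r x" "y' \<in> km_class r y" for x' y'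
    using that unfolding km_class_eq_iff by (auto simp: km_class_def intro: cong_Add km_sym)
  moreover have "x \<in> km_class r x" "y \<in> km_class r y"
    by (simp_all add: km_class_def km_refl)
  ultimately show ?thesis unfolding km_add_def by blast
qed

lemma km_scale_class: "km_scale r c (km_class r x) = km_class r (Scale c x)"
proof -
  have "km_class r (Scale c x') = km_class r (Scale c x)" if "x' \<in> km_class r x" for x'
    using that unfolding km_class_eq_iff by (auto simp: km_class_def intro: cong_Scale km_sym)
  moreover have "x \<in> km_class r x"
    by (simp add: km_class_def km_refl)
  ultimately show ?thesis unfolding km_scale_def by blast
qed

lemma km_bracket_class: "km_bracket r (km_class r x) (km_class r y) = km_class r (Br x y)"
proof -
  have "km_class r (Br x' y') = km_class r (Br x y)"
    if "x' \<in> km_class r x" "y' \<in> km_class r y" for x' y'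
    using that unfolding km_class_eq_iff by (auto simp: km_class_def intro: cong_Br km_sym)
  moreover have "x \<in> km_class r x" "y \<in> km_class r y"
    by (simp_all add: km_class_def km_refl)
  ultimately show ?thesis unfolding km_bracket_def by blast
qed


section \<open>Modules, weights and maximal dominant weights\<close>

locale affine_B_module = vector_space scale
  for r :: nat
  and scale :: "complex \<Rightarrow> 'v::ab_group_add \<Rightarrow> 'v"
  and act :: "lie_term set \<Rightarrow> 'v \<Rightarrow> 'v" +
  assumes act_linear: "X \<in> affine_B r \<Longrightarrow> Vector_Spaces.linear scale scale (act X)"
    and act_add: "X \<in> affine_B r \<Longrightarrow> Y \<in> affine_B r \<Longrightarrow>
      act (km_add r X Y) v = act X v + act Y v"
    and act_scale: "X \<in> affine_B r \<Longrightarrow> act (km_scale r c X) v = scale c (act X v)"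
    and act_bracket: "X \<in> affine_B r \<Longrightarrow> Y \<in> affine_B r \<Longrightarrow>
      act (km_bracket r X Y) v = act X (act Y v) - act Y (act X v)"
begin

definition submodule :: "'v set \<Rightarrow> bool" where
  "submodule W \<longleftrightarrow> subspace W \<and> (\<forall>X\<in>affine_B r. \<forall>w\<in>W. act X w \<in> W)"

definition irreducible_module :: bool where
  "irreducible_module \<longleftrightarrow>
    (\<exists>v::'v. v \<noteq> 0) \<and> (\<forall>W. submodule W \<longrightarrow> W = {0} \<or> W = UNIV)"

definition weight_space :: "weight \<Rightarrow> 'v set" where
  "weight_space \<mu> =
    {v. \<forall>b\<in>cartan_basis r. act (km_class r (Gen_h b)) v = scale (\<mu> b) v}"

definition weights :: "weight set" where
  "weights = {\<mu> \<in> cartan_dual r. weight_space \<mu> \<noteq> {0}}"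

definition highest_weight_module :: "weight \<Rightarrow> bool" where
  "highest_weight_module \<Lambda> \<longleftrightarrow> \<Lambda> \<in> cartan_dual r \<and>
    (\<exists>v. v \<noteq> 0 \<and> v \<in> weight_space \<Lambda> \<and> (\<forall>i\<le>r. act (km_class r (Gen_e i)) v = 0) \<and>
         (\<forall>W. submodule W \<and> v \<in> W \<longrightarrow> W = UNIV))"

definition maximal_weights :: "weight set" where
  "maximal_weights = {\<mu> \<in> weights. \<mu> + null_root r \<notin> weights}"

definition max_dominant_weights :: "weight set" where
  "max_dominant_weights = {\<mu> \<in> maximal_weights. dominant_integral r \<mu>}"

end

text \<open>
  \<open>V(\<Lambda>)\<close> is unique up to isomorphism; the following predicate says that the
  module with scalar multiplication \<open>scale\<close> and action \<open>act\<close> is a model of it.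
\<close>

locale irreducible_highest_weight_module = affine_B_module r scale act
  for r :: nat
  and \<Lambda> :: weight
  and scale :: "complex \<Rightarrow> 'v::ab_group_add \<Rightarrow> 'v"
  and act :: "lie_term set \<Rightarrow> 'v \<Rightarrow> 'v" +
  assumes irreducible: "irreducible_module"
    and highest_weight: "highest_weight_module \<Lambda>"

abbreviation max_plus_B ::
  "nat \<Rightarrow> (complex \<Rightarrow> 'v::ab_group_add \<Rightarrow> 'v) \<Rightarrow> (lie_term set \<Rightarrow> 'v \<Rightarrow> 'v) \<Rightarrow> weight set" where
  "max_plus_B \<equiv> affine_B_module.max_dominant_weights"


section \<open>Consistency of the conventions\<close>

lemma cartan_B_marks:
  assumes "3 \<le> r" "i \<le> r"
  shows "(\<Sum>j\<le>r. cartan_B r i j * int (mark_B j)) = 0"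
proof -
  have *: "(\<Sum>j\<le>r. cartan_B r i j * int (mark_B j)) = (\<Sum>j\<in>T. cartan_B r i j * int (mark_B j))"
    if "T \<subseteq> {..r}" "\<And>j. j \<le> r \<Longrightarrow> j \<notin> T \<Longrightarrow> cartan_B r i j = 0" for T
    using that by (intro sum.mono_neutral_right) auto
  consider "i = 0" | "i = 1" | "i = 2" | k where "i = Suc k" "2 \<le> k" "i < r"
    | k where "r = Suc k" "i = r" "2 \<le> k"
    using assms by (cases i; cases r) force+
  then show ?thesis
  proof cases
    case 1
    then show ?thesis
      using assms by (subst *[of "{0, 2}"]) (auto simp: cartan_B_def mark_B_def)
  next
    case 2
    then show ?thesis
      using assms by (subst *[of "{1, 2}"]) (auto simp: cartan_B_def mark_B_def)
  next
    case 3
    then show ?thesis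
      using assms by (subst *[of "{0, 1, 2, 3}"]) (auto simp: cartan_B_def mark_B_def)
  next
    case 4
    then show ?thesis
      using assms by (subst *[of "{k, Suc k, Suc (Suc k)}"]) (auto simp: cartan_B_def mark_B_def)
  next
    case 5
    then show ?thesis
      using assms by (subst *[of "{k, Suc k}"]) (auto simp: cartan_B_def mark_B_def)
  qed
qed

lemma cartan_B_comarks:
  assumes "3 \<le> r" "j \<le> r"
  shows "(\<Sum>i\<le>r. int (comark_B r i) * cartan_B r i j) = 0"
proof -
  have *: "(\<Sum>i\<le>r. int (comark_B r i) * cartan_B r i j) = (\<Sum>i\<in>T. int (comark_B r i) * cartan_B r i j)"
    if "T \<subseteq> {..r}" "\<And>i. i \<le> r \<Longrightarrow> i \<notin> T \<Longrightarrow> cartan_B r i j = 0" for T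
    using that by (intro sum.mono_neutral_right) auto
  consider "j = 0" | "j = 1" | "j = 2" | k where "j = Suc k" "2 \<le> k" "j < r"
    | k where "r = Suc k" "j = r" "2 \<le> k"
    using assms by (cases j; cases r) force+
  then show ?thesis
  proof cases
    case 1
    then show ?thesis
      using assms by (subst *[of "{0, 2}"]) (auto simp: cartan_B_def comark_B_def)
  next
    case 2
    then show ?thesis
      using assms by (subst *[of "{1, 2}"]) (auto simp: cartan_B_def comark_B_def)
  next
    case 3
    then show ?thesis
      using assms by (subst *[of "{0, 1, 2, 3}"]) (auto simp: cartan_B_def comark_B_def)
  next
    case 4
    then show ?thesis
      using assms by (subst *[of "{k, Suc k, Suc (Suc k)}"]) (auto simp: cartan_B_def comark_B_def)
  next
    case 5
    then show ?thesis
      using assms by (subst *[of "{k, Suc k}"]) (auto simp: cartan_B_def comark_B_def)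
  qed
qed

end

theory Submission
  imports Defs
begin

text \<open>
  Every weight of \<open>V(\<Lambda>)\<close> has the form \<open>\<Lambda> - \<beta>\<close> with \<open>\<beta>\<close> a sum of simple roots, and by
  \<open>sl\<^sub>2\<close> theory every dominant element of this form is a weight. Hence a maximal dominant weight
  is determined by its values on the coroots, and these are exactly the tuples \<open>(m\<^sub>0, \<dots>, m\<^sub>r)\<close> of
  the same level as \<open>\<Lambda>\<close> in its root lattice coset, which only fixes the parity of \<open>m\<^sub>r\<close>.
  Halving \<open>m\<^sub>0\<close>, \<open>m\<^sub>1\<close> and \<open>m\<^sub>r\<close> turns these tuples into compositions: for level \<open>2L + 1\<close> with
  \<open>m\<^sub>r\<close> even, and for level \<open>2L + 2\<close> with \<open>m\<^sub>r\<close> odd, there are \<open>2\<close> times \<open>L + r\<close> choose \<open>r\<close> of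
  them, which is symmetric in L and r.
\<close>

section \<open>The Cartan matrix\<close>

text \<open>The coefficients are integers, so that differences and shifts by the null root keep this
  form; values of \<open>k\<close> beyond \<open>r\<close> are ignored.\<close>

definition root_comb :: "nat \<Rightarrow> (nat \<Rightarrow> int) \<Rightarrow> weight" where
  "root_comb r k b = (\<Sum>j\<le>r. of_int (k j) * simple_root r j b)"

definition marks :: "nat \<Rightarrow> int" where
  "marks i = int (mark_B i)"

definition coroot_pairing :: "nat \<Rightarrow> (nat \<Rightarrow> int) \<Rightarrow> nat \<Rightarrow> int" where
  "coroot_pairing r k i = (\<Sum>j\<le>r. cartan_B r i j * k j)"

lemma sum_weight_apply: "(\<Sum>j\<in>A. f j) b = (\<Sum>j\<in>A. (f j :: weight) b)"
  by (induction A rule: infinite_finite_induct) auto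

lemma root_comb_marks: "root_comb r marks = null_root r"
  by (rule ext) (simp add: root_comb_def marks_def null_root_def sum_weight_apply scale_weight_def)

lemma root_comb_add: "root_comb r (\<lambda>j. k j + k' j) = root_comb r k + root_comb r k'"
  by (rule ext) (simp add: root_comb_def algebra_simps sum.distrib)

lemma root_comb_cong: "(\<And>j. j \<le> r \<Longrightarrow> k j = k' j) \<Longrightarrow> root_comb r k = root_comb r k'"
  by (rule ext) (simp add: root_comb_def)

lemma root_comb_zero: "root_comb r (\<lambda>_. 0) = 0"
  by (rule ext) (simp add: root_comb_def)

lemma root_comb_single: "j \<le> r \<Longrightarrow> root_comb r (\<lambda>i. if i = j then 1 else 0) = simple_root r j"
  by (rule ext) (simp add: root_comb_def if_distrib[of of_int] if_distrib[of "\<lambda>x. x * _"]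
      sum.delta cong: if_cong)

lemma root_comb_Coroot: "i \<le> r \<Longrightarrow> root_comb r k (Coroot i) = of_int (coroot_pairing r k i)"
  by (simp add: root_comb_def coroot_pairing_def simple_root_def mult.commute)

text \<open>Among the simple roots only \<alpha>_0 is nonzero on the scaling element. This separates
  weights that differ by a multiple of \<delta>, which agree on all coroots.\<close>

lemma root_comb_Scaling: "root_comb r k Scaling = of_int (k 0)"
proof -
  have "root_comb r k Scaling = (\<Sum>j\<le>r. if j = 0 then of_int (k j) else 0)"
    unfolding root_comb_def by (intro sum.cong) (auto simp: simple_root_def)
  then show ?thesis by simp
qed

lemma simple_root_in_cartan_dual: "simple_root r j \<in> cartan_dual r"
  by (auto simp: cartan_dual_def cartan_basis_def simple_root_def split: cartan_elt.split)

lemma root_comb_in_cartan_dual: "root_comb r k \<in> cartan_dual r"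
  using simple_root_in_cartan_dual by (auto simp: cartan_dual_def root_comb_def)

lemma add_in_cartan_dual: "\<mu> \<in> cartan_dual r \<Longrightarrow> \<nu> \<in> cartan_dual r \<Longrightarrow> \<mu> + \<nu> \<in> cartan_dual r"
  by (auto simp: cartan_dual_def)

lemma diff_in_cartan_dual: "\<mu> \<in> cartan_dual r \<Longrightarrow> \<nu> \<in> cartan_dual r \<Longrightarrow> \<mu> - \<nu> \<in> cartan_dual r"
  by (auto simp: cartan_dual_def fun_diff_def)

lemma coroot_pairing_add:
  "coroot_pairing r (\<lambda>j. k j + k' j) i = coroot_pairing r k i + coroot_pairing r k' i"
  by (simp add: coroot_pairing_def algebra_simps sum.distrib)

lemma coroot_pairing_diff:
  "coroot_pairing r (\<lambda>j. k j - k' j) i = coroot_pairing r k i - coroot_pairing r k' i"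
  by (simp add: coroot_pairing_def algebra_simps sum_subtractf)

lemma coroot_pairing_marks:
  assumes "3 \<le> r" "i \<le> r"
  shows "coroot_pairing r (\<lambda>j. c * marks j) i = 0"
proof -
  have "coroot_pairing r (\<lambda>j. c * marks j) i = c * (\<Sum>j\<le>r. cartan_B r i j * int (mark_B j))"
    unfolding coroot_pairing_def marks_def sum_distrib_left by (intro sum.cong) auto
  then show ?thesis using cartan_B_marks[OF assms] by simp
qed

text \<open>The canonical central element vanishes on every simple root, so subtracting simple roots
  from a weight preserves its level.\<close>

lemma comark_coroot_pairing:
  assumes "3 \<le> r"
  shows "(\<Sum>i\<le>r. int (comark_B r i) * coroot_pairing r k i) = 0"
proof -
  have "(\<Sum>i\<le>r. int (comark_B r i) * coroot_pairing r k i)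
      = (\<Sum>j\<le>r. k j * (\<Sum>i\<le>r. int (comark_B r i) * cartan_B r i j))"
    unfolding coroot_pairing_def sum_distrib_left
    by (subst sum.swap) (intro sum.cong, auto simp: algebra_simps)
  also have "\<dots> = 0" using cartan_B_comarks[OF assms] by simp
  finally show ?thesis .
qed

lemma cartan_B_off_diagonal: "3 \<le> r \<Longrightarrow> i \<noteq> j \<Longrightarrow> cartan_B r i j \<le> 0"
  by (auto simp: cartan_B_def)

lemma sum_comark_B:
  fixes f :: "nat \<Rightarrow> 'a::comm_semiring_1"
  assumes "3 \<le> r"
  shows "(\<Sum>i\<le>r. of_nat (comark_B r i) * f i) = f 0 + f 1 + 2 * (\<Sum>i\<in>{2..<r}. f i) + f r"
proof -
  have "{..r} = insert 0 (insert 1 (insert r {2..<r}))" using assms by auto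
  then show ?thesis using assms by (simp add: comark_B_def sum_distrib_left algebra_simps)
qed

lemma comark_pos: "comark_B r i > 0"
  by (simp add: comark_B_def)

text \<open>Row r has only the entries 0, -2 and 2. Hence the parity of the last label is constant
  on a coset of the root lattice.\<close>

lemma even_coroot_pairing_last:
  assumes "3 \<le> r"
  shows "even (coroot_pairing r k r)"
  unfolding coroot_pairing_def using assms
  by (intro dvd_sum) (auto simp: cartan_B_def)

section \<open>Kernel and image of the Cartan matrix\<close>

lemma coroot_pairing_eqs:
  assumes "3 \<le> r"
  shows "coroot_pairing r x 0 = 2 * x 0 - x 2"
    "coroot_pairing r x 1 = 2 * x 1 - x 2"
    "coroot_pairing r x 2 = 2 * x 2 - x 0 - x 1 - x 3"
    "3 \<le> i \<Longrightarrow> i < r \<Longrightarrow> coroot_pairing r x i = 2 * x i - x (i - 1) - x (i + 1)"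
proof -
  have *: "coroot_pairing r x i = (\<Sum>j\<in>T. cartan_B r i j * x j)"
    if "T \<subseteq> {..r}" "\<And>j. j \<le> r \<Longrightarrow> j \<notin> T \<Longrightarrow> cartan_B r i j = 0" for T i
    unfolding coroot_pairing_def using that by (intro sum.mono_neutral_right) auto
  show "coroot_pairing r x 0 = 2 * x 0 - x 2"
    using assms by (subst *[of "{0, 2}"]) (auto simp: cartan_B_def)
  show "coroot_pairing r x 1 = 2 * x 1 - x 2"
    using assms by (subst *[of "{1, 2}"]) (auto simp: cartan_B_def)
  show "coroot_pairing r x 2 = 2 * x 2 - x 0 - x 1 - x 3"
    using assms by (subst *[of "{0, 1, 2, 3}"]) (auto simp: cartan_B_def)
  show "coroot_pairing r x i = 2 * x i - x (i - 1) - x (i + 1)" if "3 \<le> i" "i < r"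
  proof -
    obtain k where "i = Suc k" "2 \<le> k" using \<open>3 \<le> i\<close> by (cases i) auto
    then show ?thesis
      using assms that by (subst *[of "{k, Suc k, Suc (Suc k)}"]) (auto simp: cartan_B_def)
  qed
qed

text \<open>Corank one: row 0 gives \<open>x 2\<close>, row 1 then gives \<open>x 1\<close> and row
  2 gives \<open>x 3\<close>, all in terms of \<open>x 0\<close>; the rows from 3 to r - 1 propagate
  the value to the end of the chain.\<close>

lemma coroot_pairing_kernel:
  assumes r: "3 \<le> r" and zero: "\<And>i. i \<le> r \<Longrightarrow> coroot_pairing r x i = 0" and "j \<le> r"
  shows "x j = x 0 * marks j"
proof -
  have x2: "x 2 = 2 * x 0" using coroot_pairing_eqs(1)[OF r, of x] zero[of 0] by simp
  have x1: "x 1 = x 0" using coroot_pairing_eqs(2)[OF r, of x] zero[of 1] r x2 by simp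
  have x3: "x 3 = 2 * x 0" using coroot_pairing_eqs(3)[OF r, of x] zero[of 2] r x1 x2 by simp
  \<comment> \<open>Row i + 1 is a three-term recurrence, so the induction carries two consecutive
    values.\<close>
  have "x i = 2 * x 0 \<and> (i < r \<longrightarrow> x (Suc i) = 2 * x 0)" if "2 \<le> i" "i \<le> r" for i
    using that
  proof (induction i rule: dec_induct)
    case base
    then show ?case using x2 x3 by (simp add: numeral_3_eq_3)
  next
    case (step i)
    have "x (Suc (Suc i)) = 2 * x 0" if "Suc i < r"
      using coroot_pairing_eqs(4)[OF r, of "Suc i" x] zero[of "Suc i"] step that by simp
    then show ?case using step by simp
  qed
  then have x_ge2: "2 \<le> j \<Longrightarrow> x j = 2 * x 0" using \<open>j \<le> r\<close> by blast
  consider "j = 0" | "j = 1" | "2 \<le> j" by linarith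
  then show ?thesis
    by cases (use x1 x_ge2 in \<open>simp_all add: marks_def mark_B_def\<close>)
qed

text \<open>The coroots determine the coefficients up to a multiple of the marks, and the scaling
  element removes this ambiguity by reading off the coefficient of \<alpha>_0.\<close>

lemma root_comb_inj:
  assumes r: "3 \<le> r" and eq: "root_comb r k = root_comb r k'" and "j \<le> r"
  shows "k j = k' j"
proof -
  let ?x = "\<lambda>j. k j - k' j"
  have "(of_int (coroot_pairing r k i) :: complex) = of_int (coroot_pairing r k' i)" if "i \<le> r" for i
    using fun_cong[OF eq, of "Coroot i"] that by (simp add: root_comb_Coroot)
  then have "coroot_pairing r ?x i = 0" if "i \<le> r" for i
    using that by (simp add: coroot_pairing_diff)
  then have "k j - k' j = (k 0 - k' 0) * marks j"
    using coroot_pairing_kernel[OF r, of ?x] \<open>j \<le> r\<close> by blast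
  moreover have "(of_int (k 0) :: complex) = of_int (k' 0)"
    using fun_cong[OF eq, of Scaling] by (simp add: root_comb_Scaling)
  ultimately show ?thesis by simp
qed

text \<open>
  Solves the rows 0, ..., \<open>r - 1\<close> of the linear system successively, starting from \<open>x 0 = 0\<close>;
  the comark relation then yields row r.
\<close>

fun cartan_solution :: "(nat \<Rightarrow> int) \<Rightarrow> nat \<Rightarrow> int" where
  "cartan_solution b 0 = 0"
| "cartan_solution b (Suc 0) = (b 1 - b 0) div 2"
| "cartan_solution b (Suc (Suc 0)) = - b 0"
| "cartan_solution b (Suc (Suc (Suc 0))) = - 2 * b 0 - (b 1 - b 0) div 2 - b 2"
| "cartan_solution b (Suc (Suc (Suc (Suc i)))) =
     2 * cartan_solution b (Suc (Suc (Suc i))) - cartan_solution b (Suc (Suc i)) - b (Suc (Suc (Suc i)))"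

text \<open>Every root lattice element has level zero and an even last value; the explicit solution
  shows that there are no further obstructions over the integers.\<close>

lemma coroot_pairing_surj:
  assumes r: "3 \<le> r" and level: "(\<Sum>i\<le>r. int (comark_B r i) * b i) = 0" and last: "even (b r)"
  obtains x where "\<And>i. i \<le> r \<Longrightarrow> coroot_pairing r x i = b i"
proof
  let ?x = "cartan_solution b"
  have split: "(\<Sum>i\<le>r. int (comark_B r i) * b i) = b 0 + b 1 + 2 * (\<Sum>i\<in>{2..<r}. b i) + b r"
    using sum_comark_B[OF r, of b] by simp
  \<comment> \<open>The entry \<open>x 1\<close> of the solution is half of
    \<open>b 1 - b 0\<close>; level zero and the even last entry make the division exact.\<close>
  have "b 1 - b 0 = - 2 * (b 0 + (\<Sum>i\<in>{2..<r}. b i)) - b r"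
    using split level by simp
  moreover have "even (- 2 * (b 0 + (\<Sum>i\<in>{2..<r}. b i)) - b r)" using last by simp
  ultimately have even: "even (b 1 - b 0)" by (simp only:)
  have below: "coroot_pairing r ?x i = b i" if "i < r" for i
  proof -
    consider "i = 0" | "i = 1" | "i = 2" | j where "i = Suc (Suc (Suc j))"
      by (metis One_nat_def Suc_1 not0_implies_Suc)
    then show ?thesis
    proof cases
      case 1 then show ?thesis by (simp add: coroot_pairing_eqs[OF r] numeral_2_eq_2)
    next
      case 2 then show ?thesis
        using dvd_mult_div_cancel[OF even] unfolding 2 coroot_pairing_eqs(2)[OF r]
        by (simp add: numeral_2_eq_2)
    next
      case 3 then show ?thesis
        unfolding 3 coroot_pairing_eqs(3)[OF r] by (simp add: numeral_2_eq_2 numeral_3_eq_3)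
    next
      case 4 then show ?thesis using that by (simp add: coroot_pairing_eqs(4)[OF r])
    qed
  qed
  have *: "(\<Sum>i\<le>r. f i) = (\<Sum>i<r. f i) + f r" for f :: "nat \<Rightarrow> int"
    by (simp add: lessThan_Suc_atMost[symmetric])
  \<comment> \<open>Both vectors have level zero and agree before r, and the comark of r is
    1.\<close>
  have "coroot_pairing r ?x r = b r"
    using comark_coroot_pairing[OF r, of ?x] level below by (simp add: * comark_B_def)
  then show "coroot_pairing r ?x i = b i" if "i \<le> r" for i
    using that below by (cases "i = r") auto
qed

section \<open>Connectedness of the diagram and finite type of its proper parts\<close>

text \<open>A vertex set closed under adjacency contains all of the chain 1, ..., r or none of it,
  and it contains 0 exactly if it contains 2.\<close>

lemma dynkin_connected:
  assumes r: "3 \<le> r" and R: "R \<subseteq> {..r}" "j \<in> R" "R \<noteq> {..r}"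
  obtains i j where "j \<in> R" "i \<le> r" "i \<notin> R" "cartan_B r i j < 0"
proof (rule ccontr)
  assume "\<not> thesis"
  with that have closed: "\<And>i j. j \<in> R \<Longrightarrow> i \<le> r \<Longrightarrow> cartan_B r i j < 0 \<Longrightarrow> i \<in> R" by blast
  have 0: "0 \<in> R \<longleftrightarrow> 2 \<in> R"
    using closed[of 0 2] closed[of 2 0] r by (auto simp: cartan_B_def)
  have step: "i \<in> R \<longleftrightarrow> Suc i \<in> R" if "1 \<le> i" "i < r" for i
    using closed[of i "Suc i"] closed[of "Suc i" i] that by (auto simp: cartan_B_def)
  have up: "1 \<in> R \<longleftrightarrow> i \<in> R" if "1 \<le> i" "i \<le> r" for i
    using that by (induction i rule: dec_induct) (use step in auto)
  have "i \<in> R \<longleftrightarrow> 1 \<in> R" if "i \<le> r" for i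
    using that up[of i] up[of 2] 0 r by (cases "i = 0") auto
  then show False using R by blast
qed

text \<open>
  A proper subdiagram is of finite type. The comarks annihilate the Cartan matrix from the left, so
  on the columns in R the comark-weighted sums over the rows in R are nonnegative, and one of them
  is positive by connectedness.
\<close>

lemma proper_subdiagram_positive:
  assumes r: "3 \<le> r" and R: "R \<subseteq> {..r}" "R \<noteq> {}" "R \<noteq> {..r}"
    and u: "\<And>j. j \<in> R \<Longrightarrow> u j > 0" "\<And>j. j \<le> r \<Longrightarrow> j \<notin> R \<Longrightarrow> u j = 0"
  obtains i where "i \<in> R" "coroot_pairing r u i > 0"
proof (rule ccontr)
  assume "\<not> thesis"
  with that have le: "\<And>i. i \<in> R \<Longrightarrow> coroot_pairing r u i \<le> 0" by force
  have fin: "finite R" using R finite_subset by blast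
  define c where "c j = (\<Sum>i\<in>{..r} - R. int (comark_B r i) * cartan_B r i j)" for j
  have neg: "int (comark_B r i) * cartan_B r i j \<le> 0" if "j \<in> R" "i \<notin> R" for i j
    using cartan_B_off_diagonal[OF r, of i j] that by (intro mult_nonneg_nonpos) auto
  have c_nonpos: "c j \<le> 0" if "j \<in> R" for j
    unfolding c_def using neg that by (intro sum_nonpos) auto
  obtain i0 j0 where ij: "j0 \<in> R" "i0 \<le> r" "i0 \<notin> R" "cartan_B r i0 j0 < 0"
    using dynkin_connected[OF r R(1)] R by (metis ex_in_conv)
  have "c j0 = int (comark_B r i0) * cartan_B r i0 j0
      + (\<Sum>i\<in>{..r} - R - {i0}. int (comark_B r i) * cartan_B r i j0)"
    unfolding c_def using ij by (intro sum.remove) auto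
  moreover have "(\<Sum>i\<in>{..r} - R - {i0}. int (comark_B r i) * cartan_B r i j0) \<le> 0"
    using neg ij by (intro sum_nonpos) auto
  moreover have "int (comark_B r i0) * cartan_B r i0 j0 < 0"
    using ij(4) comark_pos[of r i0] by (simp add: mult_pos_neg)
  ultimately have c_neg: "c j0 < 0" by linarith
  have col: "(\<Sum>i\<in>R. int (comark_B r i) * cartan_B r i j) = - c j" if "j \<in> R" for j
    using cartan_B_comarks[OF r, of j] sum.subset_diff[OF R(1) finite_atMost,
        of "\<lambda>i. int (comark_B r i) * cartan_B r i j"] that R unfolding c_def by auto
  have pair: "coroot_pairing r u i = (\<Sum>j\<in>R. cartan_B r i j * u j)" for i
    unfolding coroot_pairing_def using R u by (intro sum.mono_neutral_right) auto
  have "(\<Sum>i\<in>R. int (comark_B r i) * coroot_pairing r u i)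
      = (\<Sum>j\<in>R. u j * (\<Sum>i\<in>R. int (comark_B r i) * cartan_B r i j))"
    unfolding pair sum_distrib_left by (subst sum.swap) (intro sum.cong, auto simp: algebra_simps)
  also have "\<dots> = (\<Sum>j\<in>R. u j * (- c j))" using col by (intro sum.cong) auto
  also have "\<dots> > 0"
  proof (rule sum_pos2[OF fin ij(1)])
    show "0 < u j0 * - c j0" using u(1)[OF ij(1)] c_neg by (intro mult_pos_pos) auto
    show "0 \<le> u j * - c j" if "j \<in> R" for j
      using u(1)[OF that] c_nonpos[OF that] by (intro mult_nonneg_nonneg) auto
  qed
  finally have "(\<Sum>i\<in>R. int (comark_B r i) * coroot_pairing r u i) > 0" .
  moreover have "(\<Sum>i\<in>R. int (comark_B r i) * coroot_pairing r u i) \<le> 0"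
    using le by (intro sum_nonpos mult_nonneg_nonpos) auto
  ultimately show False by linarith
qed

section \<open>Weights of highest weight modules\<close>

context affine_B_module
begin

section \<open>Operators of the Chevalley generators and weight spaces\<close>

definition act_e :: "nat \<Rightarrow> 'v \<Rightarrow> 'v" where
  "act_e i = act (km_class r (Gen_e i))"

definition act_f :: "nat \<Rightarrow> 'v \<Rightarrow> 'v" where
  "act_f i = act (km_class r (Gen_f i))"

definition act_h :: "cartan_elt \<Rightarrow> 'v \<Rightarrow> 'v" where
  "act_h b = act (km_class r (Gen_h b))"

lemma class_in_affine_B [simp]: "km_class r x \<in> affine_B r"
  by (simp add: affine_B_def)

lemma act_class_linear: "Vector_Spaces.linear scale scale (act (km_class r x))"
  by (rule act_linear) simp

lemma act_class_vadd: "act (km_class r x) (v + w) = act (km_class r x) v + act (km_class r x) w"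
  using act_class_linear[of x] unfolding Vector_Spaces.linear_def module_hom_iff by blast

lemma act_class_vscale: "act (km_class r x) (scale c v) = scale c (act (km_class r x) v)"
  using act_class_linear[of x] unfolding Vector_Spaces.linear_def module_hom_iff by blast

lemma act_class_vzero: "act (km_class r x) 0 = 0"
  using act_class_vscale[of x 0 0] by simp

lemma act_class_vsum: "act (km_class r x) (\<Sum>i\<in>A. g i) = (\<Sum>i\<in>A. act (km_class r x) (g i))"
  by (induction A rule: infinite_finite_induct) (simp_all add: act_class_vadd act_class_vzero)

lemma act_e_vscale: "act_e i (scale c v) = scale c (act_e i v)"
  by (simp add: act_e_def act_class_vscale)

lemma act_f_vscale: "act_f i (scale c v) = scale c (act_f i v)"
  by (simp add: act_f_def act_class_vscale)

lemma act_e_vzero: "act_e i 0 = 0"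
  by (simp add: act_e_def act_class_vzero)

lemma act_f_vzero: "act_f i 0 = 0"
  by (simp add: act_f_def act_class_vzero)

lemma act_Add: "act (km_class r (Add x y)) v = act (km_class r x) v + act (km_class r y) v"
  by (metis act_add class_in_affine_B km_add_class)

lemma act_Scale: "act (km_class r (Scale c x)) v = scale c (act (km_class r x) v)"
  by (metis act_scale class_in_affine_B km_scale_class)

lemma act_Br: "act (km_class r (Br x y)) v
    = act (km_class r x) (act (km_class r y) v) - act (km_class r y) (act (km_class r x) v)"
  by (metis act_bracket class_in_affine_B km_bracket_class)

text \<open>Congruent terms have the same class, so every defining relation of the algebra becomes
  an identity of operators.\<close>

lemma act_cong: "km_eq r x y \<Longrightarrow> act (km_class r x) v = act (km_class r y) v"
  by (metis km_class_eq_iff)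

lemma act_Zero: "act (km_class r Zero) v = 0"
  using act_cong[OF km_eq.add_zero[of r Zero], of v] by (simp add: act_Add)

lemma he_commute:
  assumes "b \<in> cartan_basis r" "j \<le> r"
  shows "act_h b (act_e j v) = act_e j (act_h b v) + scale (simple_root r j b) (act_e j v)"
  using act_cong[OF km_eq.rel_HE[OF assms], of v]
  by (simp add: act_Br act_Scale act_e_def act_h_def algebra_simps)

lemma hf_commute:
  assumes "b \<in> cartan_basis r" "j \<le> r"
  shows "act_h b (act_f j v) = act_f j (act_h b v) - scale (simple_root r j b) (act_f j v)"
  using act_cong[OF km_eq.rel_HF[OF assms], of v]
  by (simp add: act_Br act_Scale act_f_def act_h_def algebra_simps)

lemma ef_commute:
  assumes "i \<le> r" "j \<le> r"
  shows "act_e i (act_f j v) = act_f j (act_e i v) + (if i = j then act_h (Coroot i) v else 0)"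
proof (cases "i = j")
  case True
  then show ?thesis using act_cong[OF km_eq.rel_EF[OF assms(1)], of v]
    by (simp add: act_Br act_e_def act_f_def act_h_def algebra_simps)
next
  case False
  then show ?thesis using act_cong[OF km_eq.rel_EF_ne[OF assms False], of v]
    by (simp add: act_Br act_Zero act_e_def act_f_def act_h_def algebra_simps)
qed

lemma weight_spaceD: "w \<in> weight_space \<mu> \<Longrightarrow> b \<in> cartan_basis r \<Longrightarrow> act_h b w = scale (\<mu> b) w"
  by (simp add: weight_space_def act_h_def)

lemma weight_spaceI: "(\<And>b. b \<in> cartan_basis r \<Longrightarrow> act_h b w = scale (\<mu> b) w) \<Longrightarrow> w \<in> weight_space \<mu>"
  by (simp add: weight_space_def act_h_def)

lemma subspace_weight_space: "subspace (weight_space \<mu>)"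
  by (rule subspaceI)
     (auto simp: weight_space_def act_class_vadd act_class_vscale act_class_vzero scale_right_distrib
       mult.commute)

lemma act_e_weight: "j \<le> r \<Longrightarrow> w \<in> weight_space \<mu> \<Longrightarrow> act_e j w \<in> weight_space (\<mu> + simple_root r j)"
  by (rule weight_spaceI)
     (simp add: he_commute weight_spaceD scale_left_distrib act_e_vscale)

lemma act_f_weight: "j \<le> r \<Longrightarrow> w \<in> weight_space \<mu> \<Longrightarrow> act_f j w \<in> weight_space (\<mu> - simple_root r j)"
  by (rule weight_spaceI)
     (simp add: hf_commute weight_spaceD scale_left_diff_distrib act_f_vscale fun_diff_def)

section \<open>Independence of weight vectors\<close>

text \<open>Applying some h_b and subtracting \<open>\<nu>0 b\<close> times the relation removes the
  summand of \<open>\<nu>0\<close> and scales the others by \<open>\<nu>' b - \<nu>0 b\<close>; the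
  induction hypothesis applies to what is left. For a given \<nu> the element \<open>b\<close> is
  chosen so that its factor is nonzero.\<close>

lemma weight_vectors_independent:
  assumes "finite F" "F \<subseteq> cartan_dual r" "\<And>\<nu>. \<nu> \<in> F \<Longrightarrow> w \<nu> \<in> weight_space \<nu>" "(\<Sum>\<nu>\<in>F. w \<nu>) = 0"
  shows "\<forall>\<nu>\<in>F. w \<nu> = 0"
  using assms
proof (induction F arbitrary: w rule: finite_induct)
  case (insert \<nu>0 F)
  have "w \<nu> = 0" if "\<nu> \<in> F" for \<nu>
  proof -
    have "\<nu> \<noteq> \<nu>0" using insert that by blast
    then obtain b where b: "\<nu> b \<noteq> \<nu>0 b" by blast
    \<comment> \<open>Both functionals vanish off the basis, so an element at which they differ
      belongs to it.\<close>
    then have bb: "b \<in> cartan_basis r" using insert that unfolding cartan_dual_def by (metis (mono_tags, lifting) insert_subset mem_Collect_eq subsetD)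
    have "(\<Sum>\<nu>'\<in>F. scale (\<nu>' b) (w \<nu>')) + scale (\<nu>0 b) (w \<nu>0)
        = (\<Sum>\<nu>'\<in>insert \<nu>0 F. scale (\<nu>' b) (w \<nu>'))"
      using insert.hyps by (simp add: add.commute)
    also have "\<dots> = (\<Sum>\<nu>'\<in>insert \<nu>0 F. act_h b (w \<nu>'))"
      by (rule sum.cong[OF refl]) (rule weight_spaceD[OF insert.prems(2) bb, symmetric])
    also have "\<dots> = act_h b (\<Sum>\<nu>\<in>insert \<nu>0 F. w \<nu>)"
      by (simp only: act_h_def act_class_vsum)
    also have "\<dots> = 0"
      unfolding insert.prems(3) by (simp only: act_h_def act_class_vzero)
    finally have 1: "(\<Sum>\<nu>'\<in>F. scale (\<nu>' b) (w \<nu>')) + scale (\<nu>0 b) (w \<nu>0) = 0" .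
    have "scale (\<nu>0 b) (w \<nu>0) = - (\<Sum>\<nu>'\<in>F. scale (\<nu>0 b) (w \<nu>'))"
      using insert by (simp add: scale_sum_right[symmetric] eq_neg_iff_add_eq_0
          scale_right_distrib[symmetric])
    with 1 have "(\<Sum>\<nu>'\<in>F. scale (\<nu>' b - \<nu>0 b) (w \<nu>')) = 0"
      by (simp add: scale_left_diff_distrib sum_subtractf)
    then have "\<forall>\<nu>'\<in>F. scale (\<nu>' b - \<nu>0 b) (w \<nu>') = 0"
      using insert.prems by (intro insert.IH) (auto intro: subspace_scale[OF subspace_weight_space])
    then show ?thesis using that b by auto
  qed
  then show ?case using insert by simp
qed simp

text \<open>The family \<open>w\<close> is total and zero off \<open>F\<close>, so that a new
  summand can be merged into its component whether or not its weight already occurs.\<close>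

lemma span_weight_spaces_decomp:
  assumes "x \<in> span (\<Union>\<nu>\<in>S. weight_space \<nu>)"
  shows "\<exists>F w. finite F \<and> F \<subseteq> S \<and> (\<forall>\<nu>. w \<nu> \<in> weight_space \<nu>) \<and> (\<forall>\<nu>. \<nu> \<notin> F \<longrightarrow> w \<nu> = 0) \<and> x = (\<Sum>\<nu>\<in>F. w \<nu>)"
  using assms
proof (induction rule: span_induct_alt)
  case base
  show ?case
    by (rule exI[of _ "{}"], rule exI[of _ "\<lambda>_. 0"])
       (auto intro: subspace_0[OF subspace_weight_space])
next
  case (step c x y)
  then obtain F w where F: "finite F" "F \<subseteq> S" "\<And>\<nu>. w \<nu> \<in> weight_space \<nu>"
      "\<And>\<nu>. \<nu> \<notin> F \<Longrightarrow> w \<nu> = 0" "y = (\<Sum>\<nu>\<in>F. w \<nu>)"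
    by blast
  obtain \<nu>0 where \<nu>0: "\<nu>0 \<in> S" "x \<in> weight_space \<nu>0" using step by blast
  let ?w = "w(\<nu>0 := w \<nu>0 + scale c x)"
  have "(\<Sum>\<nu>\<in>insert \<nu>0 F. ?w \<nu>) = w \<nu>0 + scale c x + (\<Sum>\<nu>\<in>F - {\<nu>0}. w \<nu>)"
    using F(1) by (simp add: sum.insert_remove)
  also have "\<dots> = scale c x + y"
  proof (cases "\<nu>0 \<in> F")
    case True then show ?thesis using F(1) by (simp add: F(5) sum.remove[of F \<nu>0] algebra_simps)
  next
    case False then show ?thesis using F(4)[of \<nu>0] by (simp add: F(5))
  qed
  finally have "scale c x + y = (\<Sum>\<nu>\<in>insert \<nu>0 F. ?w \<nu>)" by (rule sym)
  moreover have "\<forall>\<nu>. ?w \<nu> \<in> weight_space \<nu>"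
    using F(3) \<nu>0 by (auto intro: subspace_add subspace_scale subspace_weight_space)
  moreover have "\<forall>\<nu>. \<nu> \<notin> insert \<nu>0 F \<longrightarrow> ?w \<nu> = 0" using F(4) by simp
  moreover have "finite (insert \<nu>0 F)" "insert \<nu>0 F \<subseteq> S" using F \<nu>0 by auto
  ultimately show ?case by blast
qed

lemma weight_of_span:
  assumes "S \<subseteq> cartan_dual r" "x \<in> span (\<Union>\<nu>\<in>S. weight_space \<nu>)"
    and "\<mu> \<in> cartan_dual r" "x \<in> weight_space \<mu>" "x \<noteq> 0"
  shows "\<mu> \<in> S"
proof (rule ccontr)
  assume \<mu>: "\<mu> \<notin> S"
  obtain F w where F: "finite F" "F \<subseteq> S" "\<And>\<nu>. w \<nu> \<in> weight_space \<nu>" "x = (\<Sum>\<nu>\<in>F. w \<nu>)"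
    using span_weight_spaces_decomp[OF assms(2)] by blast
  have \<mu>F: "\<mu> \<notin> F" using F \<mu> by blast
  \<comment> \<open>Moving \<open>x\<close> to the other side yields a vanishing sum of weight
    vectors for distinct weights, one of which is \<open>- x\<close>.\<close>
  let ?w = "w(\<mu> := - x)"
  have "(\<Sum>\<nu>\<in>F. ?w \<nu>) = (\<Sum>\<nu>\<in>F. w \<nu>)" using \<mu>F by (intro sum.cong) auto
  then have "(\<Sum>\<nu>\<in>insert \<mu> F. ?w \<nu>) = 0" using F \<mu>F by simp
  then have "\<forall>\<nu>\<in>insert \<mu> F. ?w \<nu> = 0"
    using F assms by (intro weight_vectors_independent)
      (auto intro: subspace_neg subspace_weight_space)
  then show False using assms(5) by simp
qed

section \<open>Weights lie below the highest weight\<close>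

text \<open>The monomials in the f_i applied to the highest weight vector span a submodule, which is
  everything. Each is a weight vector whose weight is \<Lambda> minus the simple roots in its word,
  and independence excludes other weights.\<close>

lemma weights_of_highest_weight_module:
  assumes "highest_weight_module \<Lambda>" "\<mu> \<in> weights"
  obtains k :: "nat \<Rightarrow> nat" where "\<mu> = \<Lambda> - root_comb r (\<lambda>j. int (k j))"
proof -
  obtain v where \<Lambda>: "\<Lambda> \<in> cartan_dual r" and v: "v \<in> weight_space \<Lambda>"
      "\<And>i. i \<le> r \<Longrightarrow> act_e i v = 0" "\<And>W. submodule W \<Longrightarrow> v \<in> W \<Longrightarrow> W = UNIV"
    using assms(1) unfolding highest_weight_module_def act_e_def by blast
  define mono where "mono is = foldr act_f is v" for "is"
  define wt where "wt is = \<Lambda> - root_comb r (\<lambda>j. int (count_list is j))" for "is"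
  define M where "M = mono ` {is. set is \<subseteq> {..r}}"
  have wt_Cons: "wt (i # is) = wt is - simple_root r i" if "i \<le> r" for i "is"
  proof -
    have "root_comb r (\<lambda>j. int (count_list (i # is) j))
        = root_comb r (\<lambda>j. int (count_list is j) + (if j = i then 1 else 0))"
      by (rule root_comb_cong) auto
    then show ?thesis using that
      by (simp add: wt_def root_comb_add root_comb_single algebra_simps)
  qed
  have mono_weight: "mono is \<in> weight_space (wt is)" if "set is \<subseteq> {..r}" for "is"
    using that
  proof (induction "is")
    case Nil then show ?case using v(1) by (simp add: mono_def wt_def root_comb_zero)
  next
    case (Cons i "is")
    then have *: "mono (i # is) = act_f i (mono is)" "wt (i # is) = wt is - simple_root r i"
      using wt_Cons by (simp_all add: mono_def)
    show ?case unfolding * using Cons by (intro act_f_weight) auto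
  qed
  have span_invariant: "\<forall>w\<in>span M. act (km_class r x) w \<in> span M"
    if M: "\<forall>m\<in>M. act (km_class r x) m \<in> span M" for x
  proof
    fix w assume "w \<in> span M"
    then show "act (km_class r x) w \<in> span M"
      by (induction rule: span_induct_alt)
         (simp_all add: act_class_vzero act_class_vadd act_class_vscale span_zero span_add span_scale M)
  qed
  have Mf: "act_f i m \<in> span M" if "m \<in> M" "i \<le> r" for i m
  proof -
    obtain "is" where "m = mono is" "set is \<subseteq> {..r}" using \<open>m \<in> M\<close> by (auto simp: M_def)
    then have "act_f i m = mono (i # is)" "set (i # is) \<subseteq> {..r}"
      using that by (auto simp: mono_def)
    then show ?thesis unfolding M_def by (auto intro: span_base)
  qed
  have Mh: "act_h b m \<in> span M" if "m \<in> M" "b \<in> cartan_basis r" for b m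
  proof -
    obtain "is" where "m = mono is" "set is \<subseteq> {..r}" using \<open>m \<in> M\<close> by (auto simp: M_def)
    then have "act_h b m = scale (wt is b) m" using mono_weight weight_spaceD that by blast
    then show ?thesis using that by (auto intro: span_scale span_base)
  qed
  \<comment> \<open>Induction on the word: e_i is moved past the leading f_j, which for i = j leaves
    h_i acting on a shorter monomial.\<close>
  have Me: "act_e i (mono is) \<in> span M" if "i \<le> r" "set is \<subseteq> {..r}" for i "is"
    using that(2)
  proof (induction "is")
    case Nil then show ?case using v(2) that by (simp add: mono_def span_zero)
  next
    case (Cons j "is")
    then have j: "j \<le> r" and m: "mono is \<in> M" by (auto simp: M_def)
    have "act_f j (act_e i (mono is)) \<in> span M"
      using span_invariant[of "Gen_f j"] Mf Cons j by (simp add: act_f_def)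
    moreover have "act_h (Coroot i) (mono is) \<in> span M"
      using Mh m that(1) by (simp add: cartan_basis_def)
    moreover have "act_e i (mono (j # is))
        = act_f j (act_e i (mono is)) + (if i = j then act_h (Coroot i) (mono is) else 0)"
      using ef_commute[OF that(1) j] by (simp add: mono_def)
    ultimately show ?case by (cases "i = j") (simp_all add: span_add)
  qed
  \<comment> \<open>Invariance passes from the generators to all Lie terms by induction on the term;
    discarded generators act by zero.\<close>
  have "\<forall>w\<in>span M. act (km_class r x) w \<in> span M" for x
  proof (induction x)
    case (Gen_e i)
    then show ?case
    proof (cases "i \<le> r")
      case True then show ?thesis
        using Me by (intro span_invariant) (auto simp: act_e_def M_def)
    next
      case False
      then have "km_eq r (Gen_e i) Zero" by (intro km_eq.discard_E) simp_all
      from act_cong[OF this] show ?thesis by (simp add: act_Zero span_zero)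
    qed
  next
    case (Gen_f i)
    then show ?case
    proof (cases "i \<le> r")
      case True then show ?thesis
        using Mf by (intro span_invariant) (auto simp: act_f_def)
    next
      case False
      then have "km_eq r (Gen_f i) Zero" by (intro km_eq.discard_F) simp_all
      from act_cong[OF this] show ?thesis by (simp add: act_Zero span_zero)
    qed
  next
    case (Gen_h b)
    then show ?case
    proof (cases "b \<in> cartan_basis r")
      case True then show ?thesis
        using Mh by (intro span_invariant) (auto simp: act_h_def)
    next
      case False
      then have "km_eq r (Gen_h b) Zero" by (intro km_eq.discard_H) simp_all
      from act_cong[OF this] show ?thesis by (simp add: act_Zero span_zero)
    qed
  qed (auto simp: act_Zero act_Add act_Scale act_Br intro: span_zero span_add span_scale span_diff)
  then have "submodule (span M)" by (auto simp: submodule_def affine_B_def)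
  moreover have "v \<in> span M"
    unfolding M_def by (intro span_base image_eqI[of _ _ "[]"]) (auto simp: mono_def)
  ultimately have UNIV: "span M = UNIV" using v(3) by blast
  define S where "S = wt ` {is. set is \<subseteq> {..r}}"
  have "M \<subseteq> (\<Union>\<nu>\<in>S. weight_space \<nu>)" using mono_weight by (auto simp: M_def S_def)
  then have "span (\<Union>\<nu>\<in>S. weight_space \<nu>) = UNIV" using span_mono UNIV by blast
  moreover have "S \<subseteq> cartan_dual r"
    unfolding S_def wt_def using \<Lambda> by (auto intro: diff_in_cartan_dual root_comb_in_cartan_dual)
  moreover obtain x where "x \<in> weight_space \<mu>" "x \<noteq> 0" "\<mu> \<in> cartan_dual r"
    using assms(2) subspace_0[OF subspace_weight_space] by (auto simp: weights_def)
  ultimately have "\<mu> \<in> S" using weight_of_span by blast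
  then show ?thesis using that by (auto simp: S_def wt_def)
qed

section \<open>Strings for the sl_2 of a single vertex\<close>

lemma act_e_power_weight:
  assumes "i \<le> r" "w \<in> weight_space \<mu>"
  shows "(act_e i ^^ n) w \<in> weight_space (\<mu> + root_comb r (\<lambda>j. int n * (if j = i then 1 else 0)))"
proof (induction n)
  case 0 then show ?case using assms(2) by (simp add: root_comb_zero)
next
  case (Suc n)
  have "root_comb r (\<lambda>j. int (Suc n) * (if j = i then 1 else 0))
      = root_comb r (\<lambda>j. int n * (if j = i then 1 else 0) + (if j = i then 1 else 0))"
    by (rule root_comb_cong) (simp add: algebra_simps)
  then have "root_comb r (\<lambda>j. int (Suc n) * (if j = i then 1 else 0))
      = root_comb r (\<lambda>j. int n * (if j = i then 1 else 0)) + simple_root r i"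
    using assms(1) by (simp only: root_comb_add root_comb_single)
  then have "\<mu> + root_comb r (\<lambda>j. int n * (if j = i then 1 else 0)) + simple_root r i
      = \<mu> + root_comb r (\<lambda>j. int (Suc n) * (if j = i then 1 else 0))"
    by (simp only: add.assoc)
  with act_e_weight[OF assms(1) Suc] show ?case
    by (simp only: funpow.simps comp_apply)
qed

text \<open>The sl_2 formula for a lowest weight vector \<open>w\<close>: moving f_i past the
  factors e_i one after another collects the values \<mu>(h_i) + 2 m for m from 0 to n, with sum (n
  + 1)(\<mu>(h_i) + n).\<close>

lemma act_f_act_e_power:
  assumes "i \<le> r" "w \<in> weight_space \<mu>" "act_f i w = 0"
  shows "act_f i ((act_e i ^^ Suc n) w)
    = scale (- (of_nat (Suc n) * (\<mu> (Coroot i) + of_nat n))) ((act_e i ^^ n) w)"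
proof -
  have h: "act_h (Coroot i) ((act_e i ^^ n) w) = scale (\<mu> (Coroot i) + 2 * of_nat n) ((act_e i ^^ n) w)" for n
  proof -
    have "coroot_pairing r (\<lambda>j. int n * (if j = i then 1 else 0)) i = 2 * int n"
      using assms(1) by (simp add: coroot_pairing_def if_distrib[of "\<lambda>x. _ * x"] sum.delta cartan_B_def
          cong: if_cong)
    then show ?thesis
      using weight_spaceD[OF act_e_power_weight[OF assms(1,2)], of "Coroot i" n] assms(1)
      by (simp add: cartan_basis_def root_comb_Coroot)
  qed
  have fe: "act_f i (act_e i x) = act_e i (act_f i x) - act_h (Coroot i) x" for x
    using ef_commute[OF assms(1) assms(1), of x] by simp
  show ?thesis
  proof (induction n)
    case 0
    then show ?case using h[of 0] assms(3) by (simp add: fe act_e_vzero)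
  next
    case (Suc n)
    have "act_f i ((act_e i ^^ Suc (Suc n)) w)
        = act_e i (act_f i ((act_e i ^^ Suc n) w)) - act_h (Coroot i) ((act_e i ^^ Suc n) w)"
      by (simp add: fe)
    also have "\<dots> = scale (- (of_nat (Suc n) * (\<mu> (Coroot i) + of_nat n))) ((act_e i ^^ Suc n) w)
        - scale (\<mu> (Coroot i) + 2 * of_nat (Suc n)) ((act_e i ^^ Suc n) w)"
      unfolding Suc h act_e_vscale by simp
    also have "\<dots> = scale (- (of_nat (Suc (Suc n)) * (\<mu> (Coroot i) + of_nat (Suc n)))) ((act_e i ^^ Suc n) w)"
      unfolding scale_left_diff_distrib[symmetric]
      by (rule arg_cong[where f = "\<lambda>c. scale c _"]) (simp add: algebra_simps)
    finally show ?case .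
  qed
qed

text \<open>Suppose f_i kills a nonzero vector \<open>w\<close> of weight \<mu>. With \<mu>(h_i) > 0
  no coefficient of the lowest weight formula vanishes, so all e_i^n w are nonzero and \<mu> + n
  \<alpha>_i is a weight for every n. But the weights lie below \<Lambda>, which bounds n.\<close>

lemma weight_minus_simple_root:
  assumes r: "3 \<le> r" and hw: "highest_weight_module \<Lambda>" and \<mu>: "\<mu> \<in> weights" and i: "i \<le> r"
    and pos: "\<mu> (Coroot i) = of_int m" "m > 0"
  shows "\<mu> - simple_root r i \<in> weights"
proof -
  obtain w where w: "w \<in> weight_space \<mu>" "w \<noteq> 0" and \<mu>_dual: "\<mu> \<in> cartan_dual r"
    using \<mu> subspace_0[OF subspace_weight_space] by (auto simp: weights_def)
  have "act_f i w \<noteq> 0"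
  proof
    assume f: "act_f i w = 0"
    have "(act_e i ^^ n) w \<noteq> 0" for n
    proof (induction n)
      case 0 then show ?case using w by simp
    next
      case (Suc n)
      have "\<mu> (Coroot i) + of_nat n = of_int (m + int n)" by (simp add: pos)
      also have "\<dots> \<noteq> 0" using pos(2) by (subst of_int_eq_0_iff) simp
      finally have "of_nat (Suc n) * (\<mu> (Coroot i) + of_nat n) \<noteq> 0"
        by (metis mult_eq_0_iff of_nat_eq_0_iff nat.distinct(2))
      then have "act_f i ((act_e i ^^ Suc n) w) \<noteq> 0"
        using act_f_act_e_power[OF i w(1) f, of n] Suc by (simp del: of_nat_Suc)
      then show ?case by (metis act_f_vzero)
    qed
    then have weights: "\<mu> + root_comb r (\<lambda>j. int n * (if j = i then 1 else 0)) \<in> weights" for n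
      using act_e_power_weight[OF i w(1), of n] \<mu>_dual
      by (auto simp: weights_def intro: add_in_cartan_dual root_comb_in_cartan_dual)
    obtain k :: "nat \<Rightarrow> nat" where k: "\<mu> = \<Lambda> - root_comb r (\<lambda>j. int (k j))"
      using weights_of_highest_weight_module[OF hw \<mu>] by blast
    \<comment> \<open>One more than the coefficient of \<alpha>_i in \<Lambda> - \<mu>; adding this
      multiple of \<alpha>_i would make the coefficient negative.\<close>
    define n where "n = Suc (k i)"
    obtain k' :: "nat \<Rightarrow> nat" where
      "\<mu> + root_comb r (\<lambda>j. int n * (if j = i then 1 else 0)) = \<Lambda> - root_comb r (\<lambda>j. int (k' j))"
      using weights_of_highest_weight_module[OF hw weights] by blast
    then have "root_comb r (\<lambda>j. int (k' j) + int n * (if j = i then 1 else 0)) = root_comb r (\<lambda>j. int (k j))"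
      unfolding k root_comb_add by (simp add: algebra_simps)
    from root_comb_inj[OF r this i] show False by (simp add: n_def)
  qed
  then show ?thesis
    using act_f_weight[OF i w(1)] \<mu>_dual
    by (auto simp: weights_def intro: diff_in_cartan_dual simple_root_in_cartan_dual)
qed

end

section \<open>Dominant weights\<close>

context affine_B_module
begin

text \<open>
  Kac, Proposition 11.2: among the weights \<open>\<Lambda> - \<beta>\<close> with \<open>0 \<le> \<beta> \<le> \<alpha>\<close>,
  take one with \<open>\<beta>\<close> of maximal height. On the set R of vertices where \<open>\<beta>\<close> falls short of
  \<open>\<alpha>\<close>, maximality and the dominance of \<open>\<Lambda> - \<alpha>\<close> make the pairing of \<open>\<alpha> - \<beta>\<close> with
  the coroots nonpositive, so R is empty, by finiteness of type if R is proper and by positivity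
  of the level if R is everything.
\<close>

lemma dominant_below_highest_is_weight:
  fixes k :: "nat \<Rightarrow> nat"
  assumes r: "3 \<le> r" and hw: "highest_weight_module \<Lambda>"
    and \<Lambda>: "\<And>i. i \<le> r \<Longrightarrow> \<Lambda> (Coroot i) = of_int (a i)"
    and level: "(\<Sum>i\<le>r. int (comark_B r i) * a i) > 0"
    and dom: "\<And>i. i \<le> r \<Longrightarrow> coroot_pairing r (\<lambda>j. int (k j)) i \<le> a i"
  shows "\<Lambda> - root_comb r (\<lambda>j. int (k j)) \<in> weights"
proof -
  define P where "P \<beta> \<longleftrightarrow> (\<forall>j\<le>r. \<beta> j \<le> k j) \<and> \<Lambda> - root_comb r (\<lambda>j. int (\<beta> j)) \<in> weights"
    for \<beta> :: "nat \<Rightarrow> nat"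
  define height where "height \<beta> = (\<Sum>j\<le>r. \<beta> j)" for \<beta> :: "nat \<Rightarrow> nat"
  have "\<Lambda> \<in> weights"
    using hw by (auto simp: highest_weight_module_def weights_def)
  then have "P (\<lambda>_. 0)" by (simp add: P_def root_comb_zero)
  moreover have "\<forall>\<beta>. P \<beta> \<longrightarrow> height \<beta> < Suc (height k)"
    by (auto simp: P_def height_def less_Suc_eq_le intro: sum_mono)
  ultimately obtain \<beta> where \<beta>: "P \<beta>" and max: "\<And>\<gamma>. P \<gamma> \<Longrightarrow> height \<gamma> \<le> height \<beta>"
    using ex_has_greatest_nat[of P "\<lambda>_. 0" height] by blast
  define R where "R = {j. j \<le> r \<and> \<beta> j < k j}"
  define u where "u j = int (k j) - int (\<beta> j)" for j
  have pairing_le: "a i \<le> coroot_pairing r (\<lambda>j. int (\<beta> j)) i" if "i \<in> R" for i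
  proof (rule ccontr)
    assume "\<not> ?thesis"
    then have pos: "a i - coroot_pairing r (\<lambda>j. int (\<beta> j)) i > 0" by simp
    have i: "i \<le> r" "\<beta> i < k i" using that by (auto simp: R_def)
    let ?\<mu> = "\<Lambda> - root_comb r (\<lambda>j. int (\<beta> j))"
    have "?\<mu> (Coroot i) = of_int (a i - coroot_pairing r (\<lambda>j. int (\<beta> j)) i)"
      using i by (simp add: \<Lambda> root_comb_Coroot)
    then have weight: "?\<mu> - simple_root r i \<in> weights"
      using weight_minus_simple_root[OF r hw _ i(1) _ pos] \<beta> by (simp add: P_def)
    have "root_comb r (\<lambda>j. int ((\<beta>(i := Suc (\<beta> i))) j))
        = root_comb r (\<lambda>j. int (\<beta> j) + (if j = i then 1 else 0))"
      by (rule root_comb_cong) auto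
    also have "\<dots> = root_comb r (\<lambda>j. int (\<beta> j)) + simple_root r i"
      using i by (simp only: root_comb_add root_comb_single)
    finally have "P (\<beta>(i := Suc (\<beta> i)))"
      using weight \<beta> i by (simp add: P_def diff_diff_eq)
    then have "height (\<beta>(i := Suc (\<beta> i))) \<le> height \<beta>" by (rule max)
    moreover have "height (\<beta>(i := Suc (\<beta> i))) = Suc (height \<beta>)"
      using i by (simp add: height_def sum.remove[of "{..r}" i])
    ultimately show False by simp
  qed
  have u_pairing: "coroot_pairing r u i \<le> 0" if "i \<in> R" for i
    using dom[of i] pairing_le[OF that] that
    unfolding u_def coroot_pairing_diff by (simp add: R_def)
  have "R = {}"
  proof (rule ccontr)
    assume ne: "R \<noteq> {}"
    show False
    proof (cases "R = {..r}")
      case True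
      have "(\<Sum>i\<le>r. int (comark_B r i) * a i)
          \<le> (\<Sum>i\<le>r. int (comark_B r i) * coroot_pairing r (\<lambda>j. int (\<beta> j)) i)"
        using pairing_le True by (intro sum_mono mult_left_mono) auto
      then show False using level comark_coroot_pairing[OF r] by simp
    next
      case False
      have "R \<subseteq> {..r}" by (auto simp: R_def)
      moreover have "u j > 0" if "j \<in> R" for j using that by (simp add: R_def u_def)
      moreover have "u j = 0" if "j \<le> r" "j \<notin> R" for j
      proof -
        have "\<beta> j \<le> k j" using \<beta> that by (simp add: P_def)
        then show ?thesis using that by (simp add: R_def u_def)
      qed
      ultimately obtain i where "i \<in> R" "coroot_pairing r u i > 0"
        using proper_subdiagram_positive[OF r _ ne False] by metis
      then show False using u_pairing by force
    qed
  qed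
  then have "\<beta> j = k j" if "j \<le> r" for j
  proof -
    have "\<beta> j \<le> k j" using \<beta> that by (simp add: P_def)
    then show ?thesis using \<open>R = {}\<close> that by (auto simp: R_def)
  qed
  then have "root_comb r (\<lambda>j. int (\<beta> j)) = root_comb r (\<lambda>j. int (k j))"
    by (intro root_comb_cong) simp
  then show ?thesis using \<beta> by (simp add: P_def)
qed

end

section \<open>Labels of maximal dominant weights\<close>

text \<open>The floor and \<open>nat\<close> only decode: on dominant integral weights the values at
  the coroots are natural numbers already.\<close>

definition coroot_labels :: "weight \<Rightarrow> nat \<Rightarrow> nat" where
  "coroot_labels \<mu> i = nat \<lfloor>Re (\<mu> (Coroot i))\<rfloor>"

text \<open>The zeros beyond \<open>r\<close> make each tuple a unique function. At a fixed level
  the parity of the last label selects the coset of the root lattice.\<close>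

definition level_labels :: "nat \<Rightarrow> nat \<Rightarrow> nat \<Rightarrow> (nat \<Rightarrow> nat) set" where
  "level_labels r l p = {m. (\<forall>i>r. m i = 0) \<and> (\<Sum>i\<le>r. comark_B r i * m i) = l \<and> (even (m r) \<longleftrightarrow> even p)}"

lemma coroot_labels:
  assumes "dominant_integral r \<mu>" "i \<le> r"
  shows "\<mu> (Coroot i) = of_nat (coroot_labels \<mu> i)"
  using assms by (auto simp: dominant_integral_def coroot_labels_def elim!: Nats_cases)

lemma coroot_labels_outside:
  assumes "\<mu> \<in> cartan_dual r" "i > r"
  shows "coroot_labels \<mu> i = 0"
proof -
  have "Coroot i \<notin> cartan_basis r" using assms(2) by (auto simp: cartan_basis_def)
  then show ?thesis using assms(1) by (simp add: cartan_dual_def coroot_labels_def)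
qed

context affine_B_module
begin

text \<open>Passing from \<Lambda> to \<mu> subtracts simple roots, which changes neither the level
  nor the parity of the last label.\<close>

lemma coroot_labels_in_level_labels:
  assumes r: "3 \<le> r" and hw: "highest_weight_module \<Lambda>" and dom: "dominant_integral r \<Lambda>"
    and \<mu>: "\<mu> \<in> weights" "dominant_integral r \<mu>"
  shows "coroot_labels \<mu> \<in> level_labels r (\<Sum>i\<le>r. comark_B r i * coroot_labels \<Lambda> i) (coroot_labels \<Lambda> r)"
proof -
  obtain k :: "nat \<Rightarrow> nat" where k: "\<mu> = \<Lambda> - root_comb r (\<lambda>j. int (k j))"
    using weights_of_highest_weight_module[OF hw \<mu>(1)] by blast
  have label: "int (coroot_labels \<mu> i) = int (coroot_labels \<Lambda> i) - coroot_pairing r (\<lambda>j. int (k j)) i"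
    if "i \<le> r" for i
  proof -
    have "(of_int (int (coroot_labels \<mu> i)) :: complex)
        = of_int (int (coroot_labels \<Lambda> i) - coroot_pairing r (\<lambda>j. int (k j)) i)"
      using fun_cong[OF k, of "Coroot i"] coroot_labels[OF dom that] coroot_labels[OF \<mu>(2) that] that
      by (simp add: root_comb_Coroot)
    then show ?thesis by (simp only: of_int_eq_iff)
  qed
  have "int (\<Sum>i\<le>r. comark_B r i * coroot_labels \<mu> i)
      = (\<Sum>i\<le>r. int (comark_B r i) * int (coroot_labels \<Lambda> i))
        - (\<Sum>i\<le>r. int (comark_B r i) * coroot_pairing r (\<lambda>j. int (k j)) i)"
    by (simp add: label right_diff_distrib sum_subtractf)
  also have "\<dots> = int (\<Sum>i\<le>r. comark_B r i * coroot_labels \<Lambda> i)"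
    using comark_coroot_pairing[OF r] by simp
  finally have "(\<Sum>i\<le>r. comark_B r i * coroot_labels \<mu> i) = (\<Sum>i\<le>r. comark_B r i * coroot_labels \<Lambda> i)"
    by linarith
  moreover have "even (int (coroot_labels \<mu> r)) \<longleftrightarrow> even (int (coroot_labels \<Lambda> r))"
    using label[of r] even_coroot_pairing_last[OF r, of "\<lambda>j. int (k j)"] by simp
  ultimately show ?thesis
    using coroot_labels_outside \<mu>(2) by (auto simp: level_labels_def dominant_integral_def)
qed

lemma weight_add_null_root:
  "\<Lambda> - root_comb r k + null_root r = \<Lambda> - root_comb r (\<lambda>j. k j - marks j)"
proof -
  have "root_comb r k = root_comb r (\<lambda>j. k j - marks j) + null_root r"
    unfolding root_comb_marks[symmetric] root_comb_add[symmetric] by simp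
  then show ?thesis by simp
qed

text \<open>Two weights with equal labels differ by a multiple of \<delta>. If they were distinct,
  the lower one plus \<delta> would still be \<Lambda> minus a sum of simple roots, with the same
  labels, hence a weight, against maximality.\<close>

lemma inj_on_coroot_labels:
  assumes r: "3 \<le> r" and hw: "highest_weight_module \<Lambda>" and dom: "dominant_integral r \<Lambda>"
    and level: "(\<Sum>i\<le>r. comark_B r i * coroot_labels \<Lambda> i) > 0"
  shows "inj_on coroot_labels max_dominant_weights"
proof -
  have \<Lambda>: "\<Lambda> (Coroot i) = of_int (int (coroot_labels \<Lambda> i))" if "i \<le> r" for i
    using coroot_labels[OF dom that] by simp
  have pairing: "coroot_pairing r (\<lambda>j. int (k j)) i = int (coroot_labels \<Lambda> i) - int (coroot_labels \<mu> i)"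
    if "\<mu> = \<Lambda> - root_comb r (\<lambda>j. int (k j))" "\<mu> \<in> max_dominant_weights" "i \<le> r" for \<mu> k i
  proof -
    have "dominant_integral r \<mu>" using that by (simp add: max_dominant_weights_def)
    then have "(of_int (int (coroot_labels \<mu> i)) :: complex)
        = of_int (int (coroot_labels \<Lambda> i) - coroot_pairing r (\<lambda>j. int (k j)) i)"
      using fun_cong[OF that(1), of "Coroot i"] \<Lambda>[OF that(3)] coroot_labels[of r \<mu> i] that(3)
      by (simp add: root_comb_Coroot)
    then have "int (coroot_labels \<mu> i) = int (coroot_labels \<Lambda> i) - coroot_pairing r (\<lambda>j. int (k j)) i"
      by (simp only: of_int_eq_iff)
    then show ?thesis by simp
  qed
  have differ: "int (k j) = int (k' j) + (int (k 0) - int (k' 0)) * marks j"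
    if "\<mu> = \<Lambda> - root_comb r (\<lambda>j. int (k j))" "\<mu> \<in> max_dominant_weights"
      "\<mu>' = \<Lambda> - root_comb r (\<lambda>j. int (k' j))" "\<mu>' \<in> max_dominant_weights"
      "coroot_labels \<mu> = coroot_labels \<mu>'" "j \<le> r" for \<mu> \<mu>' k k' j
  proof -
    have "coroot_pairing r (\<lambda>j. int (k j) - int (k' j)) i = 0" if "i \<le> r" for i
      using pairing[OF \<open>\<mu> = _\<close> _ that] pairing[OF \<open>\<mu>' = _\<close> _ that] \<open>coroot_labels \<mu> = _\<close>
        \<open>\<mu> \<in> _\<close> \<open>\<mu>' \<in> _\<close> by (simp add: coroot_pairing_diff)
    then show ?thesis
      using coroot_pairing_kernel[OF r, of "\<lambda>j. int (k j) - int (k' j)" j] that(6) by simp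
  qed
  have le: "k 0 \<le> k' 0"
    if \<mu>: "\<mu> = \<Lambda> - root_comb r (\<lambda>j. int (k j))" "\<mu> \<in> max_dominant_weights"
      and \<mu>': "\<mu>' = \<Lambda> - root_comb r (\<lambda>j. int (k' j))" "\<mu>' \<in> max_dominant_weights"
      and eq: "coroot_labels \<mu> = coroot_labels \<mu>'" for \<mu> \<mu>' k k'
  proof (rule ccontr)
    assume "\<not> ?thesis"
    then have c: "int (k 0) - int (k' 0) \<ge> 1" by simp
    define k'' where "k'' j = nat (int (k j) - marks j)" for j
    have k'': "int (k'' j) = int (k j) - marks j" if "j \<le> r" for j
    proof -
      \<comment> \<open>As \<open>k j - k' j\<close> is at least \<open>marks j\<close>, subtracting
        the mark from \<open>k j\<close> leaves at least \<open>k' j\<close>, and the truncation by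
        \<open>nat\<close> is harmless.\<close>
      have "1 * marks j \<le> (int (k 0) - int (k' 0)) * marks j"
        using c by (intro mult_right_mono) (auto simp: marks_def)
      then show ?thesis using differ[OF \<mu> \<mu>' eq that] by (simp add: k''_def)
    qed
    have "coroot_pairing r (\<lambda>j. int (k'' j)) i \<le> int (coroot_labels \<Lambda> i)" if "i \<le> r" for i
    proof -
      have "coroot_pairing r (\<lambda>j. int (k'' j)) i = coroot_pairing r (\<lambda>j. int (k j) - marks j) i"
        unfolding coroot_pairing_def using k'' by (intro sum.cong) auto
      also have "\<dots> = coroot_pairing r (\<lambda>j. int (k j)) i"
        using coroot_pairing_marks[OF r that, of 1] by (simp add: coroot_pairing_diff)
      finally show ?thesis using pairing[OF \<mu> that] by simp
    qed
    moreover have "(\<Sum>i\<le>r. int (comark_B r i) * int (coroot_labels \<Lambda> i)) > 0"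
      using level by (metis (no_types, lifting) of_nat_0_less_iff of_nat_mult of_nat_sum sum.cong)
    ultimately have "\<Lambda> - root_comb r (\<lambda>j. int (k'' j)) \<in> weights"
      using dominant_below_highest_is_weight[OF r hw \<Lambda>] by blast
    also have "\<Lambda> - root_comb r (\<lambda>j. int (k'' j)) = \<mu> + null_root r"
      unfolding \<mu>(1) weight_add_null_root using root_comb_cong[OF k''] by simp
    finally show False using \<mu>(2) unfolding max_dominant_weights_def maximal_weights_def by blast
  qed
  show ?thesis
  proof (rule inj_onI)
    fix \<mu> \<mu>'
    assume \<mu>: "\<mu> \<in> max_dominant_weights" and \<mu>': "\<mu>' \<in> max_dominant_weights"
      and eq: "coroot_labels \<mu> = coroot_labels \<mu>'"
    obtain k :: "nat \<Rightarrow> nat" where k: "\<mu> = \<Lambda> - root_comb r (\<lambda>j. int (k j))"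
      using weights_of_highest_weight_module[OF hw, of \<mu>] \<mu>
      by (auto simp: max_dominant_weights_def maximal_weights_def)
    obtain k' :: "nat \<Rightarrow> nat" where k': "\<mu>' = \<Lambda> - root_comb r (\<lambda>j. int (k' j))"
      using weights_of_highest_weight_module[OF hw, of \<mu>'] \<mu>'
      by (auto simp: max_dominant_weights_def maximal_weights_def)
    have "k 0 = k' 0"
      using le[OF k \<mu> k' \<mu>' eq] le[OF k' \<mu>' k \<mu> eq[symmetric]] by simp
    then have "root_comb r (\<lambda>j. int (k j)) = root_comb r (\<lambda>j. int (k' j))"
      using differ[OF k \<mu> k' \<mu>' eq] by (intro root_comb_cong) simp
    then show "\<mu> = \<mu>'" using k k' by simp
  qed
qed

text \<open>The labels prescribe a root lattice element up to multiples of \<delta>. The least of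
  its shifts with nonnegative coefficients gives a weight \<mu>, and \<mu> + \<delta> would
  correspond to a smaller shift.\<close>

lemma level_labels_attained:
  assumes r: "3 \<le> r" and hw: "highest_weight_module \<Lambda>" and dom: "dominant_integral r \<Lambda>"
    and level: "(\<Sum>i\<le>r. comark_B r i * coroot_labels \<Lambda> i) > 0"
    and m: "m \<in> level_labels r (\<Sum>i\<le>r. comark_B r i * coroot_labels \<Lambda> i) (coroot_labels \<Lambda> r)"
  shows "m \<in> coroot_labels ` max_dominant_weights"
proof -
  let ?a = "\<lambda>i. int (coroot_labels \<Lambda> i)"
  have \<Lambda>: "\<Lambda> (Coroot i) = of_int (?a i)" if "i \<le> r" for i
    using coroot_labels[OF dom that] by simp
  have \<Lambda>_dual: "\<Lambda> \<in> cartan_dual r" using dom by (simp add: dominant_integral_def)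
  have "int (\<Sum>i\<le>r. comark_B r i * m i) = int (\<Sum>i\<le>r. comark_B r i * coroot_labels \<Lambda> i)"
    using m by (simp add: level_labels_def)
  then have "(\<Sum>i\<le>r. int (comark_B r i) * (?a i - int (m i))) = 0"
    by (simp add: right_diff_distrib sum_subtractf)
  moreover have "even (?a r - int (m r))" using m by (simp add: level_labels_def)
  ultimately obtain x where x: "\<And>i. i \<le> r \<Longrightarrow> coroot_pairing r x i = ?a i - int (m i)"
    using coroot_pairing_surj[OF r, of "\<lambda>i. ?a i - int (m i)"] by blast
  \<comment> \<open>Since the mark of vertex 0 is 1, \<open>shift t 0\<close> equals
    \<open>t\<close>: the parameter is the coefficient of \<alpha>_0, so natural numbers
    \<open>t\<close> cover all shifts with nonnegative coefficients.\<close>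
  define shift where "shift t j = x j + (int t - x 0) * marks j" for t :: nat and j
  have marks_pos: "marks j \<ge> 1" for j by (simp add: marks_def mark_B_def)
  have "\<exists>t. \<forall>j\<le>r. shift t j \<ge> 0"
  proof (intro exI allI impI)
    fix j assume j: "j \<le> r"
    \<comment> \<open>Large enough that \<open>int ?t - x 0\<close> dominates the absolute value of
      every \<open>x j\<close>; all marks are at least 1.\<close>
    let ?t = "nat ((\<Sum>j\<le>r. \<bar>x j\<bar>) + \<bar>x 0\<bar>)"
    have "\<bar>x j\<bar> \<le> (\<Sum>j\<le>r. \<bar>x j\<bar>)" using j by (intro member_le_sum) auto
    then have "\<bar>x j\<bar> \<le> int ?t - x 0" by simp
    moreover from this have "(int ?t - x 0) * 1 \<le> (int ?t - x 0) * marks j"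
      by (intro mult_left_mono[OF marks_pos]) simp
    ultimately show "shift ?t j \<ge> 0" by (simp add: shift_def)
  qed
  then obtain t where t: "\<And>j. j \<le> r \<Longrightarrow> shift t j \<ge> 0"
    and least: "\<And>t'. \<forall>j\<le>r. shift t' j \<ge> 0 \<Longrightarrow> t \<le> t'"
    using exists_least_iff[of "\<lambda>t. \<forall>j\<le>r. shift t j \<ge> 0"] by (meson not_le)
  define k where "k j = nat (shift t j)" for j
  have k: "int (k j) = shift t j" if "j \<le> r" for j using t[OF that] by (simp add: k_def)
  let ?\<mu> = "\<Lambda> - root_comb r (\<lambda>j. int (k j))"
  have pairing: "coroot_pairing r (\<lambda>j. int (k j)) i = ?a i - int (m i)" if "i \<le> r" for i
  proof -
    have "coroot_pairing r (\<lambda>j. int (k j)) i = coroot_pairing r (shift t) i"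
      unfolding coroot_pairing_def using k by (intro sum.cong) auto
    also have "\<dots> = coroot_pairing r x i"
      unfolding shift_def coroot_pairing_add using coroot_pairing_marks[OF r that] by simp
    finally show ?thesis using x[OF that] by simp
  qed
  have "(\<Sum>i\<le>r. int (comark_B r i) * ?a i) > 0"
    using level by (metis (no_types, lifting) of_nat_0_less_iff of_nat_mult of_nat_sum sum.cong)
  then have weight: "?\<mu> \<in> weights"
    using dominant_below_highest_is_weight[OF r hw \<Lambda>, of k] pairing by simp
  have "?\<mu> + null_root r \<notin> weights"
  proof
    assume "?\<mu> + null_root r \<in> weights"
    then obtain k' :: "nat \<Rightarrow> nat" where
      "?\<mu> + null_root r = \<Lambda> - root_comb r (\<lambda>j. int (k' j))"
      using weights_of_highest_weight_module[OF hw] by blast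
    then have "root_comb r (\<lambda>j. int (k j) - marks j) = root_comb r (\<lambda>j. int (k' j))"
      unfolding weight_add_null_root by simp
    then have "int (k j) - marks j = int (k' j)" if "j \<le> r" for j
      using root_comb_inj[OF r _ that] by blast
    then have k': "int (k j) - marks j \<ge> 0" if "j \<le> r" for j
      using that by simp
    \<comment> \<open>The coefficient of \<alpha>_0 stays nonnegative after subtracting its mark 1,
      so \<open>t\<close> is positive and \<open>t - 1\<close> is not truncated; it then contradicts
      the choice of \<open>t\<close>.\<close>
    have "shift t 0 \<ge> 1" using k'[of 0] k[of 0] marks_pos[of 0] by simp
    then have "t \<ge> 1" by (simp add: shift_def marks_def mark_B_def)
    then have "shift (t - 1) j = shift t j - marks j" for j
      by (simp add: shift_def algebra_simps of_nat_diff)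
    then have "\<forall>j\<le>r. shift (t - 1) j \<ge> 0" using k' k by simp
    then show False using least \<open>t \<ge> 1\<close> by fastforce
  qed
  moreover have \<mu>_label: "?\<mu> (Coroot i) = of_nat (m i)" if "i \<le> r" for i
    using that by (simp add: \<Lambda> root_comb_Coroot pairing)
  moreover have \<mu>_dual: "?\<mu> \<in> cartan_dual r"
    by (rule diff_in_cartan_dual[OF \<Lambda>_dual root_comb_in_cartan_dual])
  ultimately have "?\<mu> \<in> max_dominant_weights"
    using weight by (simp add: max_dominant_weights_def maximal_weights_def dominant_integral_def)
  moreover have "coroot_labels ?\<mu> = m"
  proof
    fix i show "coroot_labels ?\<mu> i = m i"
    proof (cases "i \<le> r")
      case True then show ?thesis unfolding coroot_labels_def \<mu>_label[OF True] by simp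
    next
      case False then show ?thesis
        using coroot_labels_outside[OF \<mu>_dual] m by (simp add: level_labels_def)
    qed
  qed
  ultimately show ?thesis by blast
qed

lemma max_dominant_weights_eqpoll:
  assumes r: "3 \<le> r" and hw: "highest_weight_module \<Lambda>" and dom: "dominant_integral r \<Lambda>"
    and level: "(\<Sum>i\<le>r. comark_B r i * coroot_labels \<Lambda> i) > 0"
  shows "max_dominant_weights
    \<approx> level_labels r (\<Sum>i\<le>r. comark_B r i * coroot_labels \<Lambda> i) (coroot_labels \<Lambda> r)"
proof -
  have "coroot_labels ` max_dominant_weights
      = level_labels r (\<Sum>i\<le>r. comark_B r i * coroot_labels \<Lambda> i) (coroot_labels \<Lambda> r)"
    using coroot_labels_in_level_labels[OF r hw dom] level_labels_attained[OF r hw dom level]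
    by (auto simp: max_dominant_weights_def maximal_weights_def)
  then show ?thesis
    unfolding eqpoll_def bij_betw_def using inj_on_coroot_labels[OF r hw dom level] by blast
qed

end

section \<open>Counting\<close>

lemma sum_list_split:
  assumes "3 \<le> r" "length xs = Suc r"
  shows "sum_list xs = xs ! 0 + xs ! 1 + (\<Sum>i\<in>{2..<r}. xs ! i) + (xs ! r :: nat)"
proof -
  have "{0..<length xs} = insert 0 (insert 1 (insert r {2..<r}))" using assms by auto
  then show ?thesis using assms by (simp add: sum_list_sum_nth)
qed

text \<open>
  With odd level minus p, exactly one of the labels 0 and 1 is odd. Recording which one and
  halving the labels 0, 1 and r turns the level condition into a composition of L into
  \<open>r + 1\<close> parts.
\<close>

lemma card_level_labels:
  assumes r: "3 \<le> r" and p: "p \<le> 1"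
  shows "card (level_labels r (2 * L + 1 + p) p) = 2 * ((L + r) choose L)"
proof -
  let ?C = "{xs :: nat list. length xs = Suc r \<and> sum_list xs = L}"
  \<comment> \<open>The flag \<open>e\<close> says that label 0 is the odd one of labels 0 and 1,
    and \<open>p\<close> is the remainder of label r. Labels strictly between 1 and r have comark 2
    and are taken over unchanged.\<close>
  define to_labels where "to_labels = (\<lambda>(e, xs) i.
      if i = 0 then 2 * (xs ! 0) + of_bool e else if i = 1 then 2 * (xs ! 1) + of_bool (\<not> e)
      else if i = r then 2 * (xs ! r) + p else if i < r then xs ! i else (0::nat))"
  define of_labels where "of_labels m =
      (odd (m 0), map (\<lambda>i. if i = 0 \<or> i = 1 \<or> i = r then m i div 2 else m i) [0..<Suc r])" for m :: "nat \<Rightarrow> nat"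
  have level: "(\<Sum>i\<le>r. comark_B r i * m i) = m 0 + m 1 + 2 * (\<Sum>i\<in>{2..<r}. m i) + m r" for m :: "nat \<Rightarrow> nat"
    using sum_comark_B[OF r, of m] by simp
  have "bij_betw to_labels (UNIV \<times> ?C) (level_labels r (2 * L + 1 + p) p)"
  proof (rule bij_betw_byWitness[of _ of_labels])
    show "\<forall>c\<in>UNIV \<times> ?C. of_labels (to_labels c) = c"
    proof clarify
      fix e :: bool and xs :: "nat list" assume len: "length xs = Suc r"
      have "map (\<lambda>i. if i = 0 \<or> i = 1 \<or> i = r then to_labels (e, xs) i div 2 else to_labels (e, xs) i) [0..<Suc r] = xs"
        using len p r by (intro nth_equalityI) (auto simp: to_labels_def simp del: upt_Suc)
      then show "of_labels (to_labels (e, xs)) = (e, xs)"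
        unfolding of_labels_def by (simp add: to_labels_def del: upt_Suc)
    qed
    show "to_labels ` (UNIV \<times> ?C) \<subseteq> level_labels r (2 * L + 1 + p) p"
    proof clarify
      fix e :: bool and xs :: "nat list" assume len: "length xs = Suc r"
      have mid: "(\<Sum>i\<in>{2..<r}. to_labels (e, xs) i) = (\<Sum>i\<in>{2..<r}. xs ! i)"
        by (intro sum.cong) (auto simp: to_labels_def)
      have "(\<Sum>i\<le>r. comark_B r i * to_labels (e, xs) i) = 2 * sum_list xs + 1 + p"
        unfolding level mid sum_list_split[OF r len] using r by (simp add: to_labels_def)
      moreover have "\<forall>i>r. to_labels (e, xs) i = 0" "even (to_labels (e, xs) r) \<longleftrightarrow> even p"
        using r by (auto simp: to_labels_def)
      ultimately show "to_labels (e, xs) \<in> level_labels r (2 * sum_list xs + 1 + p) p"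
        by (simp add: level_labels_def)
    qed
    have key: "to_labels (of_labels m) = m \<and> sum_list (snd (of_labels m)) = L"
      if m: "m \<in> level_labels r (2 * L + 1 + p) p" for m
    proof -
      have sum: "m 0 + m 1 + 2 * (\<Sum>i\<in>{2..<r}. m i) + m r = 2 * L + 1 + p"
        and parity: "even (m r) \<longleftrightarrow> even p" and out: "\<And>i. i > r \<Longrightarrow> m i = 0"
        using m level[of m] by (auto simp: level_labels_def)
      have mr: "m r = 2 * (m r div 2) + p" using parity p by presburger
      have odd: "odd (m 0 + m 1)" using sum mr by presburger
      have m0: "2 * (m 0 div 2) + of_bool (odd (m 0)) = m 0"
        by (cases "even (m 0)") auto
      have m1: "2 * (m 1 div 2) + of_bool (even (m 0)) = m 1"
        using odd by (cases "even (m 0)") auto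
      let ?xs = "snd (of_labels m)"
      have nth: "?xs ! i = (if i = 0 \<or> i = 1 \<or> i = r then m i div 2 else m i)" if "i \<le> r" for i
        using that by (simp add: of_labels_def nth_append del: upt_Suc)
      have "to_labels (of_labels m) i = m i" for i
      proof -
        have "of_labels m = (odd (m 0), ?xs)" by (simp add: of_labels_def)
        then have "to_labels (of_labels m) i = to_labels (odd (m 0), ?xs) i" by simp
        also have "\<dots> = m i"
          using r m0 m1 mr out[of i] by (cases i r rule: linorder_cases) (auto simp: to_labels_def nth)
        finally show ?thesis .
      qed
      moreover have "sum_list ?xs = L"
      proof -
        have "length ?xs = Suc r" by (simp add: of_labels_def)
        moreover have "(\<Sum>i\<in>{2..<r}. ?xs ! i) = (\<Sum>i\<in>{2..<r}. m i)"
          by (intro sum.cong) (auto simp: nth)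
        ultimately have "sum_list ?xs = m 0 div 2 + m 1 div 2 + (\<Sum>i\<in>{2..<r}. m i) + m r div 2"
          using sum_list_split[OF r, of ?xs] r by (simp add: nth)
        moreover have "of_bool (odd (m 0)) + of_bool (even (m 0)) = (1::nat)" by simp
        ultimately show ?thesis using sum m0 m1 mr by linarith
      qed
      ultimately show ?thesis by blast
    qed
    show "\<forall>m\<in>level_labels r (2 * L + 1 + p) p. to_labels (of_labels m) = m" using key by blast
    show "of_labels ` level_labels r (2 * L + 1 + p) p \<subseteq> UNIV \<times> ?C"
      using key by (auto simp: of_labels_def mem_Times_iff simp del: upt_Suc)
  qed
  then have "card (level_labels r (2 * L + 1 + p) p) = card ((UNIV :: bool set) \<times> ?C)"
    by (rule bij_betw_same_card[symmetric])
  \<comment> \<open>Stars and bars for the compositions; the factor 2 counts the flag.\<close>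
  also have "\<dots> = 2 * ((L + r) choose L)"
    using card_length_sum_list[of "Suc r" L] by (simp add: card_cartesian_product)
  finally show ?thesis .
qed

text \<open>Both sides are counted by twice the same binomial coefficient, by its symmetry under
  exchanging \<open>r\<close> and \<open>s\<close>.\<close>

lemma level_labels_eqpoll:
  assumes "3 \<le> r" "3 \<le> s" "p \<le> 1"
  shows "level_labels r (2 * s + 1 + p) p \<approx> level_labels s (2 * r + 1 + p) p"
proof -
  have card: "card (level_labels r (2 * s + 1 + p) p) = 2 * ((s + r) choose s)"
    "card (level_labels s (2 * r + 1 + p) p) = 2 * ((r + s) choose r)"
    using card_level_labels assms by blast+
  \<comment> \<open>\<open>card\<close> is 0 on infinite sets, so the positive counts give the
    finiteness needed to pass from equal cardinality to a bijection.\<close>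
  then have "finite (level_labels r (2 * s + 1 + p) p)" "finite (level_labels s (2 * r + 1 + p) p)"
    by (auto intro!: card_ge_0_finite)
  moreover have "(s + r) choose s = (r + s) choose r"
    using binomial_symmetric[of s "s + r"] by (simp add: add.commute)
  ultimately show ?thesis using card by (simp add: eqpoll_iff_card)
qed

section \<open>The two families of highest weights\<close>

text \<open>The vertices 0 and r both have comark 1, so this \<Lambda> has level
  \<open>c + p\<close> and last label \<open>p\<close>. The values 0 and 1 of \<open>p\<close> give
  the two families.\<close>

lemma max_plus_B_eqpoll_level_labels:
  assumes V: "irreducible_highest_weight_module r \<Lambda> scale act" and r: "3 \<le> r"
    and pos: "0 < c + p"
    and \<Lambda>: "\<Lambda> = of_nat c *\<^sub>w fundamental_weight 0 + of_nat p *\<^sub>w fundamental_weight r"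
  shows "max_plus_B r scale act \<approx> level_labels r (c + p) p"
proof -
  interpret irreducible_highest_weight_module r \<Lambda> scale act by (rule V)
  have labels: "coroot_labels \<Lambda> i = (if i = 0 then c else if i = r then p else 0)" for i
    using r by (simp add: \<Lambda> coroot_labels_def scale_weight_def fundamental_weight_def)
  have "dominant_integral r \<Lambda>"
    by (auto simp: \<Lambda> dominant_integral_def cartan_dual_def cartan_basis_def scale_weight_def
        fundamental_weight_def)
  moreover have "(\<Sum>i\<le>r. comark_B r i * coroot_labels \<Lambda> i) = c + p"
    using sum_comark_B[OF r, of "coroot_labels \<Lambda>"] r by (simp add: labels)
  moreover have "coroot_labels \<Lambda> r = p" using labels[of r] r by simp
  ultimately show ?thesis
    using max_dominant_weights_eqpoll[OF r highest_weight] pos by (simp only:)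
qed

theorem mainTheorem13:
  fixes n l :: nat
    and scale1 :: "complex \<Rightarrow> 'v1::ab_group_add \<Rightarrow> 'v1"
    and act1 :: "lie_term set \<Rightarrow> 'v1 \<Rightarrow> 'v1"
    and scale1' :: "complex \<Rightarrow> 'w1::ab_group_add \<Rightarrow> 'w1"
    and act1' :: "lie_term set \<Rightarrow> 'w1 \<Rightarrow> 'w1"
    and scale2 :: "complex \<Rightarrow> 'v2::ab_group_add \<Rightarrow> 'v2"
    and act2 :: "lie_term set \<Rightarrow> 'v2 \<Rightarrow> 'v2"
    and scale2' :: "complex \<Rightarrow> 'w2::ab_group_add \<Rightarrow> 'w2"
    and act2' :: "lie_term set \<Rightarrow> 'w2 \<Rightarrow> 'w2"
  assumes "3 \<le> n"
  shows
    "(7 \<le> l \<and> odd l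
       \<and> irreducible_highest_weight_module n
           (of_nat l *\<^sub>w fundamental_weight 0) scale1 act1
       \<and> irreducible_highest_weight_module ((l - 1) div 2)
           (of_nat (2 * n + 1) *\<^sub>w fundamental_weight 0) scale1' act1'
      \<longrightarrow> max_plus_B n scale1 act1 \<approx> max_plus_B ((l - 1) div 2) scale1' act1')
   \<and> (8 \<le> l \<and> even l
       \<and> irreducible_highest_weight_module n
           (of_nat (l - 1) *\<^sub>w fundamental_weight 0 + fundamental_weight n) scale2 act2
       \<and> irreducible_highest_weight_module (l div 2 - 1)
           (of_nat (2 * n + 1) *\<^sub>w fundamental_weight 0 + fundamental_weight (l div 2 - 1))
           scale2' act2'
      \<longrightarrow> max_plus_B n scale2 act2 \<approx> max_plus_B (l div 2 - 1) scale2' act2')"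
proof (intro conjI impI; elim conjE)
  assume l: "7 \<le> l" "odd l"
    and V: "irreducible_highest_weight_module n (of_nat l *\<^sub>w fundamental_weight 0) scale1 act1"
    and V': "irreducible_highest_weight_module ((l - 1) div 2)
      (of_nat (2 * n + 1) *\<^sub>w fundamental_weight 0) scale1' act1'"
  define L where "L = (l - 1) div 2"
  \<comment> \<open>For odd \<open>l\<close> the bound 7 is what makes \<open>L\<close> at least 3.
    The level 2 n + 1 on the other side has the same form with \<open>n\<close> and \<open>L\<close>
    exchanged.\<close>
  have L: "3 \<le> L" "l = 2 * L + 1" using l by (auto simp: L_def elim!: oddE)
  \<comment> \<open>A zero multiple of the last fundamental weight brings the highest weight into
    the common form.\<close>
  have \<Lambda>: "\<mu> = \<mu> + of_nat 0 *\<^sub>w \<nu>" for \<mu> \<nu> :: weight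
    by (rule ext) (simp add: scale_weight_def)
  have "max_plus_B n scale1 act1 \<approx> level_labels n (l + 0) 0"
    by (rule max_plus_B_eqpoll_level_labels[OF V assms _ \<Lambda>]) (use l in simp)
  also have "\<dots> \<approx> level_labels L (2 * n + 1 + 0) 0"
    using level_labels_eqpoll[OF assms L(1), of 0] L(2) by simp
  also have "\<dots> \<approx> max_plus_B L scale1' act1'"
    by (rule eqpoll_sym, rule max_plus_B_eqpoll_level_labels[OF V'[folded L_def] L(1) _ \<Lambda>]) simp
  finally show "max_plus_B n scale1 act1 \<approx> max_plus_B ((l - 1) div 2) scale1' act1'"
    by (simp only: L_def)
next
  assume l: "8 \<le> l" "even l"
    and V: "irreducible_highest_weight_module n
      (of_nat (l - 1) *\<^sub>w fundamental_weight 0 + fundamental_weight n) scale2 act2"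
    and V': "irreducible_highest_weight_module (l div 2 - 1)
      (of_nat (2 * n + 1) *\<^sub>w fundamental_weight 0 + fundamental_weight (l div 2 - 1)) scale2' act2'"
  define L where "L = l div 2 - 1"
  \<comment> \<open>The last fundamental weight adds 1 to the level, so the two levels are 2 L + 2
    and 2 n + 2, which is the count for \<open>p = 1\<close>.\<close>
  have L: "3 \<le> L" "l - 1 = 2 * L + 1" using l by (auto simp: L_def elim!: evenE)
  have \<Lambda>: "\<mu> + \<nu> = \<mu> + of_nat 1 *\<^sub>w \<nu>" for \<mu> \<nu> :: weight
    by (rule ext) (simp add: scale_weight_def)
  have "max_plus_B n scale2 act2 \<approx> level_labels n (l - 1 + 1) 1"
    by (rule max_plus_B_eqpoll_level_labels[OF V assms _ \<Lambda>]) simp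
  also have "\<dots> \<approx> level_labels L (2 * n + 1 + 1) 1"
    using level_labels_eqpoll[OF assms L(1), of 1] unfolding L(2) by simp
  also have "\<dots> \<approx> max_plus_B L scale2' act2'"
    by (rule eqpoll_sym, rule max_plus_B_eqpoll_level_labels[OF V'[folded L_def] L(1) _ \<Lambda>]) simp
  finally show "max_plus_B n scale2 act2 \<approx> max_plus_B (l div 2 - 1) scale2' act2'"
    by (simp only: L_def)
qed

end
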